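(* Let $N\ge1$, $\mathfrak{g}=\mathfrak{gl}_N(\mathbb{C})$, and let $A$ be a commutative associative unital $\mathbb{C}$-algebra. Let $T\subseteq U(\mathfrak{g}\otimes A)$ be the associative subalgebra generated by all $T_k(a_1,\dots,a_k)$ ($k\ge1$, $a_i\in A$), and let $\widetilde{T}\subseteq U(\mathfrak{g}\otimes A)$ be the $\mathbb{C}$-linear span of all operators $T_m(S,\sigma,\underline{a}_m)$, where $m\ge1$, $S$ is any single circuit with $|S|=m$, $\sigma$ is any order of $S$ and $\underline{a}_m\in A^m$. Then $\widetilde{T}=T$.
   Context: $\mathfrak{g}\otimes A$ has bracket $[x\otimes a,y\otimes b]=[x,y]\otimes ab$; $E_{ij}$ ($1\le i,j\le N$) are the matrix units of $\mathfrak{gl}_N$ and $E_{ij}(a)=E_{ij}\otimes a$. For $k\ge1$, $a_1,\dots,a_k\in A$, $$T_k(a_1,\dots,a_k)=\sum_{(i_1,\dots,i_k)\in\{1,\dots,N\}^k}E_{i_1i_2}(a_1)E_{i_2i_3}(a_2)\cdots E_{i_ki_1}(a_k)\in U(\mathfrak{g}\otimes A).$$ The subalgebra $T$ is understood as the linear span of all finite non-empty products of such elements (it is not required to contain $1$). Circuits: consider finite non-empty sets $S$ of ordered pairs $(x,y)$ of symbols ("index variables"); $x$ is the start point and $y$ the end point of $(x,y)$. Two pairs $(x,y),(z,w)$ are connected if $y=z$ or $x=w$. $S$ is a circuit if (1) each variable occurs at most once as a start point and at most once as an end point; (2) a variable occurring as a start point also occurs as an end point, and conversely; (3) any two elements of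 $S$ can be joined by a sequence of elements of $S$ in which consecutive elements are connected. Equivalently, up to renaming, $S=\{(i_1,i_2),(i_2,i_3),\dots,(i_m,i_1)\}$ with $i_1,\dots,i_m$ distinct variables ($\{(i_1,i_1)\}$ when $m=1$). An order $\sigma$ of $S$ with $|S|=m$ is a listing $(x_1,y_1),\dots,(x_m,y_m)$ of all the elements of $S$. For $\underline{a}_m=(a_1,\dots,a_m)\in A^m$ define $$T_m(S,\sigma,\underline{a}_m)=\sum E_{x_1y_1}(a_1)E_{x_2y_2}(a_2)\cdots E_{x_my_m}(a_m)\in U(\mathfrak{g}\otimes A),$$ where the sum runs over all assignments of values in $\{1,\dots,N\}$ to the variables occurring in $S$. *)

theory Defs
  imports "HOL-Analysis.Analysis" "HOL-Library.Poly_Mapping" "HOL-Library.FuncSet"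
begin

section \<open>Complex vector spaces, algebras and Lie algebras\<close>

class complex_vector = ab_group_add +
  fixes scaleC :: "complex \<Rightarrow> 'a \<Rightarrow> 'a" (infixr \<open>*\<^sub>C\<close> 75)
  assumes scaleC_add_right: "c *\<^sub>C (x + y) = c *\<^sub>C x + c *\<^sub>C y"
    and scaleC_add_left: "(c + d) *\<^sub>C x = c *\<^sub>C x + d *\<^sub>C x"
    and scaleC_scaleC: "c *\<^sub>C (d *\<^sub>C x) = (c * d) *\<^sub>C x"
    and scaleC_one: "1 *\<^sub>C x = x"

global_interpretation complex_vector: vector_space "scaleC :: complex \<Rightarrow> 'a \<Rightarrow> 'a::complex_vector"
  by unfold_locales (simp_all add: scaleC_add_right scaleC_add_left scaleC_scaleC scaleC_one)

text \<open>
  Unital commutative associative complex algebras.  The class is not based on \<^class>\<open>comm_ring_1\<close>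
  because that would exclude the zero algebra.
\<close>

class comm_complex_algebra = complex_vector + comm_ring + comm_monoid_mult +
  assumes mult_scaleC_left: "(c *\<^sub>C x) * y = c *\<^sub>C (x * y)"

class complex_lie_algebra = complex_vector +
  fixes lie_bracket :: "'a \<Rightarrow> 'a \<Rightarrow> 'a"
  assumes lie_bracket_add_left: "lie_bracket (x + y) z = lie_bracket x z + lie_bracket y z"
    and lie_bracket_add_right: "lie_bracket x (y + z) = lie_bracket x y + lie_bracket x z"
    and lie_bracket_scaleC_left: "lie_bracket (c *\<^sub>C x) y = c *\<^sub>C lie_bracket x y"
    and lie_bracket_scaleC_right: "lie_bracket x (c *\<^sub>C y) = c *\<^sub>C lie_bracket x y"
    and lie_bracket_self: "lie_bracket x x = 0"
    and lie_bracket_jacobi: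
      "lie_bracket x (lie_bracket y z) + lie_bracket y (lie_bracket z x)
        + lie_bracket z (lie_bracket x y) = 0"

lemma mult_scaleC_right: "x * (c *\<^sub>C y) = c *\<^sub>C (x * y)" for x :: "'a::comm_complex_algebra"
  using mult_scaleC_left[of c y x] by (simp add: mult.commute)

lemma lie_bracket_commute: "lie_bracket x y = - lie_bracket y x"
  for x :: "'a::complex_lie_algebra"
proof -
  have "0 = lie_bracket (x + y) (x + y)"
    by (rule lie_bracket_self[symmetric])
  also have "\<dots> = lie_bracket x y + lie_bracket y x"
    by (simp only: lie_bracket_add_left lie_bracket_add_right) (simp add: lie_bracket_self)
  finally show ?thesis
    by (metis add_eq_0_iff add.commute)
qed

instantiation complex :: comm_complex_algebra
begin

definition scaleC_complex :: "complex \<Rightarrow> complex \<Rightarrow> complex" where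
  "scaleC_complex = (*)"

instance
  by standard (simp_all add: scaleC_complex_def algebra_simps)

end


section \<open>The Lie algebra of complex matrices\<close>

text \<open>
  The indices range over an arbitrary finite type \<open>'n\<close>, which is automatically non-empty;
  \<open>CARD('n)\<close> is the size of the matrices.
\<close>

typedef 'n gl = "UNIV :: (complex ^ 'n ^ 'n) set"
  morphisms mat_of_gl gl_of_mat ..

setup_lifting type_definition_gl

instantiation gl :: (finite) complex_lie_algebra
begin

lift_definition zero_gl :: "'a gl" is 0 .
lift_definition plus_gl :: "'a gl \<Rightarrow> 'a gl \<Rightarrow> 'a gl" is "(+)" .
lift_definition uminus_gl :: "'a gl \<Rightarrow> 'a gl" is uminus .
lift_definition minus_gl :: "'a gl \<Rightarrow> 'a gl \<Rightarrow> 'a gl" is "(-)" .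
lift_definition scaleC_gl :: "complex \<Rightarrow> 'a gl \<Rightarrow> 'a gl" is "\<lambda>c X. \<chi> i j. c * X $ i $ j" .
lift_definition lie_bracket_gl :: "'a gl \<Rightarrow> 'a gl \<Rightarrow> 'a gl" is "\<lambda>X Y. X ** Y - Y ** X" .

instance
proof
  have scale: "(\<chi> i j. c * X $ i $ j) ** Y = (\<chi> i j. c * (X ** Y) $ i $ j)"
    "X ** (\<chi> i j. c * Y $ i $ j) = (\<chi> i j. c * (X ** Y) $ i $ j)"
    for c and X Y :: "complex ^ 'a ^ 'a"
    by (simp_all add: matrix_matrix_mult_def vec_eq_iff sum_distrib_left ac_simps)
  have rdistrib: "(X + Y) ** Z = X ** Z + Y ** Z"
    and ldiff: "Z ** (X - Y) = Z ** X - Z ** Y"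
    and rdiff: "(X - Y) ** Z = X ** Z - Y ** Z" for X Y Z :: "complex ^ 'a ^ 'a"
    by (simp_all add: matrix_matrix_mult_def vec_eq_iff sum.distrib sum_subtractf algebra_simps)
  fix x y z :: "'a gl" and c d :: complex
  show "x + y + z = x + (y + z)" by transfer simp
  show "x + y = y + x" by transfer simp
  show "0 + x = x" by transfer simp
  show "- x + x = 0" by transfer simp
  show "x - y = x + - y" by transfer simp
  show "c *\<^sub>C (x + y) = c *\<^sub>C x + c *\<^sub>C y"
    by transfer (simp add: vec_eq_iff algebra_simps)
  show "(c + d) *\<^sub>C x = c *\<^sub>C x + d *\<^sub>C x"
    by transfer (simp add: vec_eq_iff algebra_simps)
  show "c *\<^sub>C (d *\<^sub>C x) = (c * d) *\<^sub>C x"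
    by transfer (simp add: vec_eq_iff algebra_simps)
  show "1 *\<^sub>C x = x" by transfer (simp add: vec_eq_iff)
  show "lie_bracket (x + y) z = lie_bracket x z + lie_bracket y z"
    by transfer (simp add: matrix_add_ldistrib rdistrib)
  show "lie_bracket x (y + z) = lie_bracket x y + lie_bracket x z"
    by transfer (simp add: matrix_add_ldistrib rdistrib)
  show "lie_bracket (c *\<^sub>C x) y = c *\<^sub>C lie_bracket x y"
    by transfer (simp add: scale, simp add: vec_eq_iff algebra_simps)
  show "lie_bracket x (c *\<^sub>C y) = c *\<^sub>C lie_bracket x y"
    by transfer (simp add: scale, simp add: vec_eq_iff algebra_simps)
  show "lie_bracket x x = 0" by transfer simp
  show "lie_bracket x (lie_bracket y z) + lie_bracket y (lie_bracket z x)
      + lie_bracket z (lie_bracket x y) = 0"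
    by transfer (simp add: ldiff rdiff matrix_mul_assoc)
qed

end

lift_definition matrix_unit :: "'n \<Rightarrow> 'n \<Rightarrow> 'n::finite gl" is
  "\<lambda>i j. \<chi> k l. if k = i \<and> l = j then 1 else 0" .

lemma lie_bracket_matrix_unit:
  "lie_bracket (matrix_unit i j) (matrix_unit k l) =
     (if j = k then matrix_unit i l else 0) - (if l = i then matrix_unit k j else 0)"
proof -
  have *: "(\<Sum>m\<in>UNIV. (if P \<and> m = j then 1 else 0) * (if m = k \<and> Q then 1 else 0))
      = (if P \<and> j = k \<and> Q then 1 else (0::complex))" for P Q and j k :: 'a
    by (rule trans[OF sum.cong[OF refl, of _ _ "\<lambda>m. if m = j then (if P \<and> j = k \<and> Q then 1 else 0) else 0"]])
      auto
  show ?thesis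
    by transfer (auto simp: matrix_matrix_mult_def vec_eq_iff *)
qed


section \<open>Free vector spaces and tensor products\<close>

instantiation poly_mapping :: (type, complex_vector) complex_vector
begin

lift_definition scaleC_poly_mapping :: "complex \<Rightarrow> ('a \<Rightarrow>\<^sub>0 'b) \<Rightarrow> 'a \<Rightarrow>\<^sub>0 'b" is "\<lambda>c f k. c *\<^sub>C f k"
  by (rule finite_subset[rotated]) auto

instance
  by standard (transfer; simp add: scaleC_add_right scaleC_add_left scaleC_scaleC scaleC_one)+

end

text \<open>
  \<^typ>\<open>'b \<times> 'c \<Rightarrow>\<^sub>0 complex\<close> is the free vector space on the set of pairs \<open>(x, a)\<close>; the tensor product
  is its quotient by the subspace spanned by the bilinearity relations.
\<close>

definition tensor_relations :: "('b::complex_vector \<times> 'c::complex_vector \<Rightarrow>\<^sub>0 complex) set" where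
  "tensor_relations =
     {Poly_Mapping.single (x + y, a) 1 - Poly_Mapping.single (x, a) 1 - Poly_Mapping.single (y, a) 1
        | x y a. True}
   \<union> {Poly_Mapping.single (x, a + b) 1 - Poly_Mapping.single (x, a) 1 - Poly_Mapping.single (x, b) 1
        | x a b. True}
   \<union> {Poly_Mapping.single (c *\<^sub>C x, a) 1 - c *\<^sub>C Poly_Mapping.single (x, a) 1 | c x a. True}
   \<union> {Poly_Mapping.single (x, c *\<^sub>C a) 1 - c *\<^sub>C Poly_Mapping.single (x, a) 1 | c x a. True}"

definition tensor_rel ::
  "('b::complex_vector \<times> 'c::complex_vector \<Rightarrow>\<^sub>0 complex) \<Rightarrow> ('b \<times> 'c \<Rightarrow>\<^sub>0 complex) \<Rightarrow> bool" where
  "tensor_rel p q \<longleftrightarrow> p - q \<in> complex_vector.span tensor_relations"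

lemma equivp_tensor_rel: "equivp tensor_rel"
proof (rule equivpI)
  show "reflp tensor_rel"
    by (auto simp: reflp_def tensor_rel_def complex_vector.span_zero)
  show "symp tensor_rel"
    using complex_vector.span_neg by (fastforce simp: symp_def tensor_rel_def)
  show "transp tensor_rel"
    using complex_vector.span_add by (fastforce simp: transp_def tensor_rel_def)
qed

quotient_type (overloaded) ('b, 'c) tensor =
  "'b::complex_vector \<times> 'c::complex_vector \<Rightarrow>\<^sub>0 complex" / tensor_rel
  by (rule equivp_tensor_rel)

instantiation tensor :: (complex_vector, complex_vector) complex_vector
begin

lift_definition zero_tensor :: "('a, 'b) tensor" is 0 .

lift_definition plus_tensor :: "('a, 'b) tensor \<Rightarrow> ('a, 'b) tensor \<Rightarrow> ('a, 'b) tensor" is "(+)"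
  unfolding tensor_rel_def by (drule (1) complex_vector.span_add) (simp add: algebra_simps)

lift_definition uminus_tensor :: "('a, 'b) tensor \<Rightarrow> ('a, 'b) tensor" is uminus
  unfolding tensor_rel_def by (drule complex_vector.span_neg) simp

lift_definition minus_tensor :: "('a, 'b) tensor \<Rightarrow> ('a, 'b) tensor \<Rightarrow> ('a, 'b) tensor" is "(-)"
  unfolding tensor_rel_def by (drule (1) complex_vector.span_diff) (simp add: algebra_simps)

lift_definition scaleC_tensor :: "complex \<Rightarrow> ('a, 'b) tensor \<Rightarrow> ('a, 'b) tensor" is scaleC
  unfolding tensor_rel_def
  by (drule complex_vector.span_scale) (simp add: complex_vector.scale_right_diff_distrib)

instance
proof -
  have eq: "p = q \<Longrightarrow> tensor_rel p q" for p q :: "'a \<times> 'b \<Rightarrow>\<^sub>0 complex"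
    using equivp_reflp[OF equivp_tensor_rel] by blast
  show "OFCLASS(('a, 'b) tensor, complex_vector_class)"
    by standard
      (transfer; rule eq;
        simp add: scaleC_add_right scaleC_add_left scaleC_scaleC scaleC_one algebra_simps)+
qed

end

lift_definition tensor :: "'b::complex_vector \<Rightarrow> 'c::complex_vector \<Rightarrow> ('b, 'c) tensor"
    (infixr \<open>\<otimes>\<close> 76)
  is "\<lambda>x a. Poly_Mapping.single (x, a) 1" .

lemma
  shows tensor_add_left: "(x + y) \<otimes> a = x \<otimes> a + y \<otimes> a"
    and tensor_add_right: "x \<otimes> (a + b) = x \<otimes> a + x \<otimes> b"
    and tensor_scaleC_left: "(c *\<^sub>C x) \<otimes> a = c *\<^sub>C (x \<otimes> a)"
    and tensor_scaleC_right: "x \<otimes> (c *\<^sub>C a) = c *\<^sub>C (x \<otimes> a)"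
  by (transfer; unfold tensor_rel_def diff_diff_eq[symmetric]; rule complex_vector.span_base;
      unfold tensor_relations_def; blast)+

definition linear_extension :: "('k \<Rightarrow> 'd::complex_vector) \<Rightarrow> ('k \<Rightarrow>\<^sub>0 complex) \<Rightarrow> 'd" where
  "linear_extension g p = (\<Sum>k\<in>Poly_Mapping.keys p. Poly_Mapping.lookup p k *\<^sub>C g k)"

lemma linear_extension_superset:
  assumes "finite S" "Poly_Mapping.keys p \<subseteq> S"
  shows "linear_extension g p = (\<Sum>k\<in>S. Poly_Mapping.lookup p k *\<^sub>C g k)"
  unfolding linear_extension_def
  by (rule sum.mono_neutral_left) (use assms in \<open>auto simp: in_keys_iff\<close>)

lemma linear_extension_single [simp]: "linear_extension g (Poly_Mapping.single k c) = c *\<^sub>C g k"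
  by (subst linear_extension_superset[of "{k}"]) auto

lemma linear_extension_add: "linear_extension g (p + q) = linear_extension g p + linear_extension g q"
  using Poly_Mapping.keys_add[of p q]
  by (simp add: linear_extension_superset[of "Poly_Mapping.keys p \<union> Poly_Mapping.keys q"]
      lookup_add scaleC_add_left sum.distrib)

lemma linear_extension_scaleC: "linear_extension g (c *\<^sub>C p) = c *\<^sub>C linear_extension g p"
proof -
  have "Poly_Mapping.keys (c *\<^sub>C p) \<subseteq> Poly_Mapping.keys p"
    by (auto simp: in_keys_iff scaleC_poly_mapping.rep_eq)
  then show ?thesis
    by (simp add: linear_extension_superset[of "Poly_Mapping.keys p"] scaleC_poly_mapping.rep_eq
        complex_vector.scale_sum_right scaleC_scaleC scaleC_complex_def)
qed

lemma linear_extension_diff: "linear_extension g (p - q) = linear_extension g p - linear_extension g q"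
  using linear_extension_add[of g "p - q" q] by simp

lemma free_vector_induct [case_names zero add]:
  fixes p :: "'k \<Rightarrow>\<^sub>0 complex"
  assumes "P 0" and "\<And>k c p. P p \<Longrightarrow> P (c *\<^sub>C Poly_Mapping.single k 1 + p)"
  shows "P p"
proof (induction p rule: Poly_Mapping.update_induct)
  case const
  show ?case by fact
next
  case (update p k c)
  have "Poly_Mapping.update k c p = c *\<^sub>C Poly_Mapping.single k 1 + p"
    using update.hyps
    by (intro poly_mapping_eqI)
      (auto simp: lookup_update lookup_add lookup_single scaleC_poly_mapping.rep_eq
        scaleC_complex_def in_keys_iff when_def)
  with assms(2) update show ?case by simp
qed

lemma tensor_induct [case_names zero add]:
  fixes t :: "('b::complex_vector, 'c::complex_vector) tensor"
  assumes "P 0" and "\<And>x a t. P t \<Longrightarrow> P (x \<otimes> a + t)"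
  shows "P t"
proof -
  have "P (abs_tensor p)" for p
  proof (induction p rule: free_vector_induct)
    case zero
    show ?case using assms(1) by (simp add: zero_tensor_def)
  next
    case (add k c p)
    have "abs_tensor (c *\<^sub>C Poly_Mapping.single k 1 + p) = (c *\<^sub>C fst k) \<otimes> snd k + abs_tensor p"
      unfolding tensor_scaleC_left by (simp add: plus_tensor.abs_eq scaleC_tensor.abs_eq tensor.abs_eq)
    with assms(2) add show ?case by simp
  qed
  then show ?thesis by (metis Quotient3_abs_rep[OF Quotient3_tensor])
qed

definition bilinear_map :: "('b::complex_vector \<Rightarrow> 'c::complex_vector \<Rightarrow> 'd::complex_vector) \<Rightarrow> bool"
  where "bilinear_map f \<longleftrightarrow>
    (\<forall>x y a. f (x + y) a = f x a + f y a) \<and> (\<forall>x a b. f x (a + b) = f x a + f x b) \<and>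
    (\<forall>c x a. f (c *\<^sub>C x) a = c *\<^sub>C f x a) \<and> (\<forall>c x a. f x (c *\<^sub>C a) = c *\<^sub>C f x a)"

definition tensor_lift ::
  "('b::complex_vector \<Rightarrow> 'c::complex_vector \<Rightarrow> 'd::complex_vector) \<Rightarrow> ('b, 'c) tensor \<Rightarrow> 'd" where
  "tensor_lift f t = linear_extension (\<lambda>(x, a). f x a) (rep_tensor t)"

lemma tensor_lift_abs:
  assumes "bilinear_map f"
  shows "tensor_lift f (abs_tensor p) = linear_extension (\<lambda>(x, a). f x a) p"
proof -
  have zero: "linear_extension (\<lambda>(x, a). f x a) r = 0"
    if "r \<in> complex_vector.span tensor_relations" for r
    using that
  proof (induction rule: complex_vector.span_induct_alt)
    case base
    show ?case by (simp add: linear_extension_def)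
  next
    case (step c x y)
    from step.hyps have "linear_extension (\<lambda>(x, a). f x a) x = 0"
      using assms unfolding tensor_relations_def bilinear_map_def
      by (auto simp: linear_extension_diff linear_extension_scaleC scaleC_one)
    with step.IH show ?case by (simp add: linear_extension_add linear_extension_scaleC)
  qed
  have "tensor_rel (rep_tensor (abs_tensor p)) p"
    by (rule Quotient3_rep_abs[OF Quotient3_tensor equivp_reflp[OF equivp_tensor_rel]])
  from zero[OF this[unfolded tensor_rel_def]] show ?thesis
    by (simp add: tensor_lift_def linear_extension_diff)
qed

lemma
  assumes "bilinear_map f"
  shows tensor_lift_tensor: "tensor_lift f (x \<otimes> a) = f x a"
    and tensor_lift_add: "tensor_lift f (t + u) = tensor_lift f t + tensor_lift f u"
    and tensor_lift_scaleC: "tensor_lift f (c *\<^sub>C t) = c *\<^sub>C tensor_lift f t"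
    and tensor_lift_zero: "tensor_lift f 0 = 0"
proof -
  note abs = tensor_lift_abs[OF assms]
  have ex: "\<exists>p. t = abs_tensor p" for t :: "('a, 'b) tensor"
    by (metis Quotient3_abs_rep[OF Quotient3_tensor])
  show "tensor_lift f (x \<otimes> a) = f x a"
    by (simp add: tensor.abs_eq abs scaleC_one)
  show "tensor_lift f (t + u) = tensor_lift f t + tensor_lift f u"
    using ex[of t] ex[of u] by (auto simp: plus_tensor.abs_eq abs linear_extension_add)
  show *: "tensor_lift f (c *\<^sub>C t) = c *\<^sub>C tensor_lift f t" for c t
    using ex[of t] by (auto simp: scaleC_tensor.abs_eq abs linear_extension_scaleC)
  show "tensor_lift f 0 = 0"
    using *[of 0 0] by simp
qed


section \<open>The Lie algebra structure on a tensor product with a commutative algebra\<close>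

definition pure_bracket ::
  "'g::complex_lie_algebra \<Rightarrow> 'a::comm_complex_algebra \<Rightarrow> ('g, 'a) tensor \<Rightarrow> ('g, 'a) tensor"
  where "pure_bracket x a u = tensor_lift (\<lambda>y b. lie_bracket x y \<otimes> (a * b)) u"

definition tensor_bracket ::
  "('g::complex_lie_algebra, 'a::comm_complex_algebra) tensor \<Rightarrow> ('g, 'a) tensor \<Rightarrow> ('g, 'a) tensor"
  where "tensor_bracket t u = tensor_lift (\<lambda>x a. pure_bracket x a u) t"

lemma bilinear_pure_bracket: "bilinear_map (\<lambda>y b. lie_bracket x y \<otimes> (a * b))"
  for x :: "'g::complex_lie_algebra" and a :: "'a::comm_complex_algebra"
  by (simp add: bilinear_map_def lie_bracket_add_right lie_bracket_scaleC_right tensor_add_left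
      tensor_add_right tensor_scaleC_left tensor_scaleC_right distrib_left mult_scaleC_right)

lemmas pure_bracket_simps =
  tensor_lift_tensor[OF bilinear_pure_bracket, folded pure_bracket_def]
  tensor_lift_add[OF bilinear_pure_bracket, folded pure_bracket_def]
  tensor_lift_scaleC[OF bilinear_pure_bracket, folded pure_bracket_def]
  tensor_lift_zero[OF bilinear_pure_bracket, folded pure_bracket_def]

lemma
  shows pure_bracket_add_left: "pure_bracket (x + y) a u = pure_bracket x a u + pure_bracket y a u"
    and pure_bracket_add_right: "pure_bracket x (a + b) u = pure_bracket x a u + pure_bracket x b u"
    and pure_bracket_scaleC_left: "pure_bracket (c *\<^sub>C x) a u = c *\<^sub>C pure_bracket x a u"
    and pure_bracket_scaleC_right: "pure_bracket x (c *\<^sub>C a) u = c *\<^sub>C pure_bracket x a u"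
  by (induction u rule: tensor_induct)
    (simp_all add: pure_bracket_simps lie_bracket_add_left lie_bracket_scaleC_left tensor_add_left
      tensor_add_right tensor_scaleC_left tensor_scaleC_right distrib_right mult_scaleC_left
      scaleC_add_right)

lemma bilinear_tensor_bracket: "bilinear_map (\<lambda>x a. pure_bracket x a u)"
  by (simp add: bilinear_map_def pure_bracket_add_left pure_bracket_add_right
      pure_bracket_scaleC_left pure_bracket_scaleC_right)

lemmas tensor_bracket_simps =
  tensor_lift_tensor[OF bilinear_tensor_bracket, folded tensor_bracket_def]
  tensor_lift_add[OF bilinear_tensor_bracket, folded tensor_bracket_def]
  tensor_lift_scaleC[OF bilinear_tensor_bracket, folded tensor_bracket_def]
  tensor_lift_zero[OF bilinear_tensor_bracket, folded tensor_bracket_def]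

lemma tensor_bracket_tensor:
  "tensor_bracket (x \<otimes> a) (y \<otimes> b) = lie_bracket x y \<otimes> (a * b)"
  by (simp add: tensor_bracket_simps pure_bracket_simps)

lemma tensor_bracket_add:
  "tensor_bracket (t + t') u = tensor_bracket t u + tensor_bracket t' u"
  "tensor_bracket t (u + u') = tensor_bracket t u + tensor_bracket t u'"
proof -
  show "tensor_bracket (t + t') u = tensor_bracket t u + tensor_bracket t' u"
    by (simp add: tensor_bracket_simps)
  show "tensor_bracket t (u + u') = tensor_bracket t u + tensor_bracket t u'"
    by (induction t rule: tensor_induct) (simp_all add: tensor_bracket_simps pure_bracket_simps)
qed

lemma tensor_bracket_scaleC:
  "tensor_bracket (c *\<^sub>C t) u = c *\<^sub>C tensor_bracket t u"
  "tensor_bracket t (c *\<^sub>C u) = c *\<^sub>C tensor_bracket t u"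
proof -
  show "tensor_bracket (c *\<^sub>C t) u = c *\<^sub>C tensor_bracket t u"
    by (simp add: tensor_bracket_simps)
  show "tensor_bracket t (c *\<^sub>C u) = c *\<^sub>C tensor_bracket t u"
    by (induction t rule: tensor_induct)
      (simp_all add: tensor_bracket_simps pure_bracket_simps scaleC_add_right)
qed

lemma tensor_bracket_zero: "tensor_bracket 0 u = 0" "tensor_bracket t 0 = 0"
  using tensor_bracket_scaleC(1)[of 0 0 u] tensor_bracket_scaleC(2)[of t 0 0] by simp_all

lemma tensor_zero_left: "0 \<otimes> a = 0"
  using tensor_scaleC_left[of 0 0 a] by simp

lemma tensor_minus_left: "(- x) \<otimes> a = - (x \<otimes> a)"
  using tensor_scaleC_left[of "- 1" x a] by simp

lemma tensor_bracket_commute: "tensor_bracket t u = - tensor_bracket u t"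
proof (induction t rule: tensor_induct)
  case zero
  show ?case by (simp add: tensor_bracket_zero)
next
  case (add x a t)
  have "tensor_bracket (x \<otimes> a) u = - tensor_bracket u (x \<otimes> a)"
  proof (induction u rule: tensor_induct)
    case zero
    show ?case by (simp add: tensor_bracket_zero)
  next
    case (add y b u)
    then show ?case
      using lie_bracket_commute[of x y]
      by (simp add: tensor_bracket_add tensor_bracket_tensor mult.commute tensor_minus_left)
  qed
  with add show ?case by (simp add: tensor_bracket_add)
qed

instantiation tensor :: (complex_lie_algebra, comm_complex_algebra) complex_lie_algebra
begin

definition lie_bracket_tensor :: "('a, 'b) tensor \<Rightarrow> ('a, 'b) tensor \<Rightarrow> ('a, 'b) tensor" where
  "lie_bracket_tensor = tensor_bracket"

instance
proof
  fix t u v :: "('a, 'b) tensor" and c :: complex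
  show "lie_bracket (t + u) v = lie_bracket t v + lie_bracket u v"
    "lie_bracket t (u + v) = lie_bracket t u + lie_bracket t v"
    by (simp_all add: lie_bracket_tensor_def tensor_bracket_add)
  show "lie_bracket (c *\<^sub>C t) u = c *\<^sub>C lie_bracket t u"
    "lie_bracket t (c *\<^sub>C u) = c *\<^sub>C lie_bracket t u"
    by (simp_all add: lie_bracket_tensor_def tensor_bracket_scaleC)
  show "lie_bracket t t = 0"
    unfolding lie_bracket_tensor_def
  proof (induction t rule: tensor_induct)
    case zero
    show ?case by (simp add: tensor_bracket_zero)
  next
    case (add x a t)
    then show ?case
      using tensor_bracket_commute[of "x \<otimes> a" t]
      by (simp add: tensor_bracket_add tensor_bracket_tensor lie_bracket_self tensor_zero_left)
  qed
  let ?J = "\<lambda>t u v :: ('a, 'b) tensor. tensor_bracket t (tensor_bracket u v)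
    + tensor_bracket u (tensor_bracket v t) + tensor_bracket v (tensor_bracket t u)"
  have J_add: "?J (t + t') u v = ?J t u v + ?J t' u v" "?J t (u + u') v = ?J t u v + ?J t u' v"
    "?J t u (v + v') = ?J t u v + ?J t u v'" for t t' u u' v v'
    by (simp_all add: tensor_bracket_add algebra_simps)
  have 1: "?J (x \<otimes> a) (y \<otimes> b) (z \<otimes> d) = 0" for x y z :: 'a and a b d :: 'b
    using lie_bracket_jacobi[of x y z]
    by (simp add: tensor_bracket_tensor ac_simps tensor_add_left[symmetric] tensor_zero_left)
  have 2: "?J (x \<otimes> a) (y \<otimes> b) v = 0" for x y :: 'a and a b :: 'b and v
    by (induction v rule: tensor_induct) (simp add: tensor_bracket_zero, simp only: J_add 1 add_0)
  have 3: "?J (x \<otimes> a) u v = 0" for x :: 'a and a :: 'b and u v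
    by (induction u rule: tensor_induct) (simp add: tensor_bracket_zero, simp only: J_add 2 add_0)
  have "?J t u v = 0"
    by (induction t rule: tensor_induct) (simp add: tensor_bracket_zero, simp only: J_add 3 add_0)
  then show "lie_bracket t (lie_bracket u v) + lie_bracket u (lie_bracket v t)
      + lie_bracket v (lie_bracket t u) = 0"
    by (simp add: lie_bracket_tensor_def)
qed

end

lemma lie_bracket_tensor: "lie_bracket (x \<otimes> a) (y \<otimes> b) = lie_bracket x y \<otimes> (a * b)"
  by (simp add: lie_bracket_tensor_def tensor_bracket_tensor)


section \<open>Universal enveloping algebras\<close>

text \<open>
  With concatenation as addition of words, the convolution product makes
  \<^typ>\<open>'l list \<Rightarrow>\<^sub>0 complex\<close> the free associative unital algebra on the set \<open>'l\<close>.
\<close>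

instantiation list :: (type) monoid_add
begin

definition zero_list :: "'a list" where "zero_list = []"
definition plus_list :: "'a list \<Rightarrow> 'a list \<Rightarrow> 'a list" where "plus_list = (@)"

instance
  by standard (simp_all add: zero_list_def plus_list_def)

end

definition free_gen :: "'l \<Rightarrow> ('l list \<Rightarrow>\<^sub>0 complex)" where
  "free_gen x = Poly_Mapping.single [x] 1"

text \<open>
  The two-sided ideal generated by the linearity relations (whose quotient is the tensor algebra)
  and the relations \<open>x y - y x - [x, y]\<close>.
\<close>

inductive_set uea_ideal :: "('l::complex_lie_algebra list \<Rightarrow>\<^sub>0 complex) set" where
  add_rel: "free_gen (x + y) - free_gen x - free_gen y \<in> uea_ideal"
| scale_rel: "free_gen (c *\<^sub>C x) - c *\<^sub>C free_gen x \<in> uea_ideal"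
| bracket_rel: "free_gen x * free_gen y - free_gen y * free_gen x - free_gen (lie_bracket x y) \<in> uea_ideal"
| zero: "0 \<in> uea_ideal"
| add: "p \<in> uea_ideal \<Longrightarrow> q \<in> uea_ideal \<Longrightarrow> p + q \<in> uea_ideal"
| mult_left: "p \<in> uea_ideal \<Longrightarrow> r * p \<in> uea_ideal"
| mult_right: "p \<in> uea_ideal \<Longrightarrow> p * r \<in> uea_ideal"

lemma uea_ideal_minus: "p \<in> uea_ideal \<Longrightarrow> - p \<in> uea_ideal"
  using uea_ideal.mult_left[of p "- 1"] by simp

lemma uea_ideal_diff: "p \<in> uea_ideal \<Longrightarrow> q \<in> uea_ideal \<Longrightarrow> p - q \<in> uea_ideal"
  using uea_ideal.add[of p "- q"] uea_ideal_minus[of q] by simp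

lemma scaleC_free_conv_mult: "c *\<^sub>C p = Poly_Mapping.single 0 c * p"
  for p :: "'l list \<Rightarrow>\<^sub>0 complex"
  unfolding mult_map_scale_conv_mult[symmetric]
  by (intro poly_mapping_eqI)
    (simp add: scaleC_poly_mapping.rep_eq Poly_Mapping.map.rep_eq scaleC_complex_def when_def)

lemma scaleC_free_conv_mult_right: "c *\<^sub>C p = p * Poly_Mapping.single 0 c"
  for p :: "'l list \<Rightarrow>\<^sub>0 complex"
proof (induction p rule: free_vector_induct)
  case (add k d p)
  then show ?case
    by (simp add: scaleC_add_right distrib_right)
      (simp add: scaleC_free_conv_mult mult_single mult.commute)
qed (simp add: complex_vector.scale_zero_right)

definition uea_rel ::
  "('l::complex_lie_algebra list \<Rightarrow>\<^sub>0 complex) \<Rightarrow> ('l list \<Rightarrow>\<^sub>0 complex) \<Rightarrow> bool" where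
  "uea_rel p q \<longleftrightarrow> p - q \<in> uea_ideal"

lemma equivp_uea_rel: "equivp uea_rel"
proof (rule equivpI)
  show "reflp uea_rel"
    by (auto simp: reflp_def uea_rel_def uea_ideal.zero)
  show "symp uea_rel"
    using uea_ideal_minus by (fastforce simp: symp_def uea_rel_def)
  show "transp uea_rel"
    using uea_ideal.add by (fastforce simp: transp_def uea_rel_def)
qed

quotient_type (overloaded) 'l uea = "'l::complex_lie_algebra list \<Rightarrow>\<^sub>0 complex" / uea_rel
  by (rule equivp_uea_rel)

text \<open>The constant term is a character of the free algebra vanishing on the ideal, hence
  \<open>0 \<noteq> 1\<close> in the quotient.\<close>

lemma lookup_mult_Nil:
  "Poly_Mapping.lookup (p * q) [] = Poly_Mapping.lookup p [] * Poly_Mapping.lookup q []"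
  for p q :: "'l list \<Rightarrow>\<^sub>0 complex"
proof (induction p rule: free_vector_induct)
  case (add k c p)
  have single: "Poly_Mapping.lookup (Poly_Mapping.single k c * q) []
      = Poly_Mapping.lookup (Poly_Mapping.single k c) [] * Poly_Mapping.lookup q []" for k :: "'l list" and c
  proof (induction q rule: free_vector_induct)
    case (add l d q)
    have "Poly_Mapping.lookup (Poly_Mapping.single k c * (d *\<^sub>C Poly_Mapping.single l 1)) []
      = Poly_Mapping.lookup (Poly_Mapping.single k c) []
        * Poly_Mapping.lookup (d *\<^sub>C Poly_Mapping.single l (1::complex)) []"
      by (auto simp: scaleC_free_conv_mult mult_single lookup_single plus_list_def zero_list_def when_def)
    with add show ?case by (simp add: distrib_left lookup_add)
  qed simp
  have "c *\<^sub>C Poly_Mapping.single k 1 = Poly_Mapping.single k c"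
    by (simp add: scaleC_free_conv_mult mult_single)
  with add single[of k c] show ?case by (simp add: distrib_right lookup_add)
qed simp

lemma uea_ideal_lookup_Nil: "p \<in> uea_ideal \<Longrightarrow> Poly_Mapping.lookup p [] = 0"
  by (induction rule: uea_ideal.induct)
    (simp_all add: lookup_mult_Nil lookup_minus lookup_add free_gen_def lookup_single
      scaleC_poly_mapping.rep_eq)

instantiation uea :: (complex_lie_algebra) "{ring_1, complex_vector}"
begin

lift_definition zero_uea :: "'a uea" is 0 .

lift_definition one_uea :: "'a uea" is 1 .

lift_definition plus_uea :: "'a uea \<Rightarrow> 'a uea \<Rightarrow> 'a uea" is "(+)"
  unfolding uea_rel_def by (drule (1) uea_ideal.add) (simp add: algebra_simps)

lift_definition uminus_uea :: "'a uea \<Rightarrow> 'a uea" is uminus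
  unfolding uea_rel_def by (drule uea_ideal_minus) simp

lift_definition minus_uea :: "'a uea \<Rightarrow> 'a uea \<Rightarrow> 'a uea" is "(-)"
  unfolding uea_rel_def by (drule (1) uea_ideal_diff) (simp add: algebra_simps)

lift_definition times_uea :: "'a uea \<Rightarrow> 'a uea \<Rightarrow> 'a uea" is "(*)"
proof -
  fix p p' q q' :: "'a list \<Rightarrow>\<^sub>0 complex"
  assume "uea_rel p p'" "uea_rel q q'"
  then have "(p - p') * q + p' * (q - q') \<in> uea_ideal"
    unfolding uea_rel_def by (intro uea_ideal.add uea_ideal.mult_left uea_ideal.mult_right)
  then show "uea_rel (p * q) (p' * q')"
    unfolding uea_rel_def by (simp add: algebra_simps)
qed

lift_definition scaleC_uea :: "complex \<Rightarrow> 'a uea \<Rightarrow> 'a uea" is scaleC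
  unfolding uea_rel_def
  by (drule uea_ideal.mult_left) (simp add: scaleC_free_conv_mult right_diff_distrib)

instance
proof -
  have eq: "p = q \<Longrightarrow> uea_rel p q" for p q :: "'a list \<Rightarrow>\<^sub>0 complex"
    using equivp_reflp[OF equivp_uea_rel] by blast
  have neq: "0 \<noteq> (1 :: 'a uea)"
  proof (transfer, rule notI)
    assume "uea_rel (0 :: 'a list \<Rightarrow>\<^sub>0 complex) 1"
    then have "- 1 \<in> (uea_ideal :: ('a list \<Rightarrow>\<^sub>0 complex) set)"
      by (simp add: uea_rel_def)
    from uea_ideal_lookup_Nil[OF this] show False
      by (simp add: lookup_one zero_list_def)
  qed
  show "OFCLASS('a uea, ring_1_class)"
    by (intro_classes; (rule neq | (transfer; rule eq; simp add: algebra_simps)))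
  show "OFCLASS('a uea, complex_vector_class)"
    by (intro_classes; transfer; rule eq;
        simp add: scaleC_add_right scaleC_add_left scaleC_scaleC scaleC_one algebra_simps)
qed

end

lift_definition uea_gen :: "'l::complex_lie_algebra \<Rightarrow> 'l uea" is free_gen .

lemma uea_mult_scaleC:
  "(c *\<^sub>C p) * q = c *\<^sub>C (p * q)" "p * (c *\<^sub>C q) = c *\<^sub>C (p * q)"
  for p q :: "'l::complex_lie_algebra uea"
proof -
  have eq: "p = q \<Longrightarrow> uea_rel p q" for p q :: "'l list \<Rightarrow>\<^sub>0 complex"
    using equivp_reflp[OF equivp_uea_rel] by blast
  show "(c *\<^sub>C p) * q = c *\<^sub>C (p * q)"
    by (transfer; rule eq; simp add: scaleC_free_conv_mult mult.assoc)
  show "p * (c *\<^sub>C q) = c *\<^sub>C (p * q)"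
    by (transfer; rule eq; simp add: scaleC_free_conv_mult_right mult.assoc)
qed

lemma
  shows uea_gen_add: "uea_gen (x + y) = uea_gen x + uea_gen y"
    and uea_gen_scaleC: "uea_gen (c *\<^sub>C x) = c *\<^sub>C uea_gen x"
    and uea_gen_lie_bracket: "uea_gen (lie_bracket x y) = uea_gen x * uea_gen y - uea_gen y * uea_gen x"
proof -
  show "uea_gen (x + y) = uea_gen x + uea_gen y"
    using uea_ideal.add_rel[of x y] by transfer (simp add: uea_rel_def algebra_simps)
  show "uea_gen (c *\<^sub>C x) = c *\<^sub>C uea_gen x"
    using uea_ideal.scale_rel[of c x] by transfer (simp add: uea_rel_def)
  show "uea_gen (lie_bracket x y) = uea_gen x * uea_gen y - uea_gen y * uea_gen x"
    using uea_ideal_minus[OF uea_ideal.bracket_rel[of x y]] by transfer (simp add: uea_rel_def)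
qed


section \<open>Trace elements and circuits\<close>

definition gen_E :: "'n \<Rightarrow> 'n \<Rightarrow> 'a \<Rightarrow> ('n::finite gl, 'a::comm_complex_algebra) tensor uea" where
  "gen_E i j a = uea_gen (matrix_unit i j \<otimes> a)"

lemma gen_E_commutator:
  fixes i j k l :: "'n::finite" and a b :: "'a::comm_complex_algebra"
  shows "gen_E i j a * gen_E k l b - gen_E k l b * gen_E i j a =
     (if j = k then gen_E i l (a * b) else 0) - (if l = i then gen_E k j (a * b) else 0)"
proof -
  have gen_0: "uea_gen (0 :: ('n gl, 'a) tensor) = 0" and gen_minus: "uea_gen (- x) = - uea_gen x"
    for x :: "('n gl, 'a) tensor"
    using uea_gen_scaleC[of 0 x] uea_gen_scaleC[of "- 1" x] by simp_all
  have "uea_gen ((x - y) \<otimes> c) = uea_gen (x \<otimes> c) - uea_gen (y \<otimes> c)" for x y :: "'n gl" and c :: 'a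
    using uea_gen_add[of "x \<otimes> c" "(- y) \<otimes> c"] tensor_add_left[of x "- y" c]
    by (simp add: tensor_minus_left gen_minus)
  then show ?thesis
    by (simp add: gen_E_def uea_gen_lie_bracket[symmetric] lie_bracket_tensor lie_bracket_matrix_unit
        tensor_zero_left gen_0)
qed

text \<open>
  The argument is the tuple \<open>(a\<^sub>1, \<dots>, a\<^sub>k)\<close>; positions are counted from \<open>0\<close>, cyclically.
\<close>

definition trace_elem :: "'a list \<Rightarrow> ('n::finite gl, 'a::comm_complex_algebra) tensor uea" where
  "trace_elem as =
     (\<Sum>is\<in>{is :: 'n list. length is = length as}.
        (\<Prod>j\<leftarrow>[0..<length as]. gen_E (is ! j) (is ! (Suc j mod length as)) (as ! j)))"

text \<open>The generated subalgebra is not required to contain \<open>1\<close>.\<close>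

definition trace_algebra :: "('n::finite gl, 'a::comm_complex_algebra) tensor uea set" where
  "trace_algebra = complex_vector.span
     {prod_list us | us. us \<noteq> [] \<and> (\<forall>u\<in>set us. \<exists>as. as \<noteq> [] \<and> u = trace_elem as)}"

definition connected_pairs :: "'v \<times> 'v \<Rightarrow> 'v \<times> 'v \<Rightarrow> bool" where
  "connected_pairs p q \<longleftrightarrow> snd p = fst q \<or> fst p = snd q"

definition circuit :: "('v \<times> 'v) set \<Rightarrow> bool" where
  "circuit S \<longleftrightarrow> finite S \<and> S \<noteq> {} \<and> inj_on fst S \<and> inj_on snd S \<and> fst ` S = snd ` S \<and>
     (\<forall>p\<in>S. \<forall>q\<in>S. (p, q) \<in> {(r, s). r \<in> S \<and> s \<in> S \<and> connected_pairs r s}\<^sup>*)"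

definition order_of :: "('v \<times> 'v) set \<Rightarrow> ('v \<times> 'v) list \<Rightarrow> bool" where
  "order_of S \<sigma> \<longleftrightarrow> distinct \<sigma> \<and> set \<sigma> = S"

definition circuit_vars :: "('v \<times> 'v) set \<Rightarrow> 'v set" where
  "circuit_vars S = fst ` S \<union> snd ` S"

definition circuit_elem ::
  "('v \<times> 'v) set \<Rightarrow> ('v \<times> 'v) list \<Rightarrow> 'a list \<Rightarrow> ('n::finite gl, 'a::comm_complex_algebra) tensor uea"
  where "circuit_elem S \<sigma> as =
    (\<Sum>f\<in>circuit_vars S \<rightarrow>\<^sub>E (UNIV :: 'n set). (\<Prod>((x, y), a)\<leftarrow>zip \<sigma> as. gen_E (f x) (f y) a))"

text \<open>Natural numbers serve as the supply of index variables.\<close>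

definition circuit_span :: "('n::finite gl, 'a::comm_complex_algebra) tensor uea set" where
  "circuit_span = complex_vector.span
     {circuit_elem S \<sigma> as | (S :: (nat \<times> nat) set) \<sigma> as.
        circuit S \<and> order_of S \<sigma> \<and> length as = card S}"

end

theory Submission
  imports Defs "HOL-Combinatorics.Orbits"
begin

text \<open>
  Both sides are compared with a third space, spanned by the elements of \<^emph>\<open>disjoint unions\<close> of
  circuits.  Since each index variable starts exactly one edge, such a union is a permutation \<open>\<pi>\<close> of
  the variables: the edge starting at \<open>x\<close> ends at \<open>\<pi> x\<close>, and an order of the edges is a list of the
  variables (\<open>perm_elem\<close>).  Single circuits are the cyclic permutations.

  Everything rests on what happens when two neighbouring factors are exchanged
  (\<open>perm_elem_exchange\<close>).  The commutator
  \<open>[E\<^bsub>xy\<^esub>(a), E\<^bsub>zw\<^esub>(b)] = \<delta>\<^bsub>yz\<^esub> E\<^bsub>xw\<^esub>(ab) - \<delta>\<^bsub>wx\<^esub> E\<^bsub>zy\<^esub>(ab)\<close> identifies two index variables and fuses two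
  edges, so the error consists of two elements of the same kind with one edge less.  If \<open>y\<close> and \<open>z\<close>
  are already the same variable, that variable is left without an edge and its free summation
  contributes a factor \<open>N\<close>.

  \<^item> Up to shorter elements the order is therefore irrelevant.  Listing the edges
    cycle by cycle, along each cycle, turns the element into a product of trace elements, and
    induction on the number of edges gives \<open>perm_elem_in_trace_algebra\<close>.
  \<^item> Read backwards, the same identity joins cycles.  Given a cycle \<open>D\<close> through \<open>d\<close>
    and an edge \<open>(x, w)\<close> outside \<open>D\<close>, cut \<open>d\<close> into two variables, \<open>d\<close> for the outgoing
    and \<open>z\<close> for the incoming edge, and replace \<open>(x, w)\<close> by
    the neighbours \<open>(x, d)\<close> with coefficient \<open>a\<close> and \<open>(z, w)\<close> with coefficient \<open>1\<close>.  This yields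
    one cycle in place of two.  The exchange of the two neighbours gives back the original element and an element in
    which \<open>x\<close> has left its cycle and \<open>D\<close> has grown.  Either way fewer variables lie outside the cycle of
    \<open>d\<close>, and induction on their number gives \<open>perm_elem_in_circuit_span\<close>.

  It remains to note that circuit elements and products of trace elements are both elements of this
  kind.
\<close>

section \<open>Elements of disjoint unions of circuits\<close>

definition edge_word :: "('v \<Rightarrow> 'v) \<Rightarrow> ('v \<Rightarrow> 'a) \<Rightarrow> ('v \<Rightarrow> 'n) \<Rightarrow> 'v list \<Rightarrow>
    ('n::finite gl, 'a::comm_complex_algebra) tensor uea" where
  "edge_word \<pi> a f xs = (\<Prod>x\<leftarrow>xs. gen_E (f x) (f (\<pi> x)) (a x))"

definition perm_elem :: "('v \<Rightarrow> 'v) \<Rightarrow> ('v \<Rightarrow> 'a) \<Rightarrow> 'v list \<Rightarrow>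
    ('n::finite gl, 'a::comm_complex_algebra) tensor uea" where
  "perm_elem \<pi> a xs = (\<Sum>f\<in>set xs \<rightarrow>\<^sub>E (UNIV :: 'n set). edge_word \<pi> a f xs)"

lemma edge_word_simps [simp]:
  "edge_word \<pi> a f [] = 1"
  "edge_word \<pi> a f (x # xs) = gen_E (f x) (f (\<pi> x)) (a x) * edge_word \<pi> a f xs"
  "edge_word \<pi> a f (xs @ ys) = edge_word \<pi> a f xs * edge_word \<pi> a f ys"
  by (simp_all add: edge_word_def)

lemma edge_word_cong:
  assumes "\<And>x. x \<in> set xs \<Longrightarrow> f x = g x" "\<And>x. x \<in> set xs \<Longrightarrow> f (\<pi> x) = g (\<rho> x)"
    "\<And>x. x \<in> set xs \<Longrightarrow> a x = b x"
  shows "edge_word \<pi> a f xs = edge_word \<rho> b g xs"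
  unfolding edge_word_def by (intro arg_cong[of _ _ prod_list] map_cong) (simp_all add: assms)

lemma perm_elem_cong:
  assumes "\<And>x. x \<in> set xs \<Longrightarrow> \<pi> x = \<rho> x" "\<And>x. x \<in> set xs \<Longrightarrow> a x = b x"
  shows "perm_elem \<pi> a xs = perm_elem \<rho> b xs"
  unfolding perm_elem_def by (intro sum.cong edge_word_cong) (simp_all add: assms)

text \<open>If no edge leads from the variables \<open>xs\<close> to \<open>ys\<close> or back, the sum over all assignments factorises.\<close>

lemma perm_elem_append:
  fixes a :: "'v \<Rightarrow> 'a::comm_complex_algebra"
  assumes "set xs \<inter> set ys = {}" "\<pi> ` set xs \<subseteq> set xs" "\<pi> ` set ys \<subseteq> set ys"
  shows "(perm_elem \<pi> a (xs @ ys) :: ('n::finite gl, 'a) tensor uea) = perm_elem \<pi> a xs * perm_elem \<pi> a ys"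
proof -
  let ?X = "set xs \<rightarrow>\<^sub>E (UNIV :: 'n set)" and ?Y = "set ys \<rightarrow>\<^sub>E (UNIV :: 'n set)"
  have "perm_elem \<pi> a xs * perm_elem \<pi> a ys
      = (\<Sum>(f, g)\<in>?X \<times> ?Y. edge_word \<pi> a f xs * edge_word \<pi> a g ys)"
    by (simp add: perm_elem_def sum_product sum.cartesian_product)
  also have "\<dots> = (\<Sum>f\<in>set (xs @ ys) \<rightarrow>\<^sub>E UNIV. edge_word \<pi> a f (xs @ ys))"
  proof (rule sum.reindex_bij_witness[where
        i = "\<lambda>f. (restrict f (set xs), restrict f (set ys))" and
        j = "\<lambda>(f, g). \<lambda>x\<in>set xs \<union> set ys. if x \<in> set xs then f x else g x"])
    fix fg :: "('v \<Rightarrow> 'n) \<times> ('v \<Rightarrow> 'n)" assume fg: "fg \<in> ?X \<times> ?Y"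
    obtain f g where [simp]: "fg = (f, g)" by (cases fg)
    have ext: "f x = undefined" if "x \<notin> set xs" for x using fg that by (auto simp: PiE_def extensional_def)
    have ext': "g x = undefined" if "x \<notin> set ys" for x using fg that by (auto simp: PiE_def extensional_def)
    let ?h = "\<lambda>x\<in>set xs \<union> set ys. if x \<in> set xs then f x else g x"
    show "(restrict (case fg of (f, g) \<Rightarrow> \<lambda>x\<in>set xs \<union> set ys. if x \<in> set xs then f x else g x) (set xs),
        restrict (case fg of (f, g) \<Rightarrow> \<lambda>x\<in>set xs \<union> set ys. if x \<in> set xs then f x else g x) (set ys)) = fg"
      using assms(1) by (auto simp: fun_eq_iff ext ext' restrict_def)
    have "edge_word \<pi> a ?h xs = edge_word \<pi> a f xs"
      using assms(2) by (intro edge_word_cong) auto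
    moreover have "edge_word \<pi> a ?h ys = edge_word \<pi> a g ys"
      using assms(1,3) by (intro edge_word_cong) auto
    ultimately show "edge_word \<pi> a
        (case fg of (f, g) \<Rightarrow> \<lambda>x\<in>set xs \<union> set ys. if x \<in> set xs then f x else g x) (xs @ ys) =
        (case fg of (f, g) \<Rightarrow> edge_word \<pi> a f xs * edge_word \<pi> a g ys)"
      by simp
  qed (auto simp: fun_eq_iff restrict_def PiE_def extensional_def)
  finally show ?thesis by (simp add: perm_elem_def)
qed


section \<open>Exchanging two neighbours\<close>

text \<open>
  The permutation \<open>\<rho>\<close> with \<open>z\<close> removed from its cycle: the predecessor of \<open>z\<close> is sent to \<open>\<rho> z\<close>.
  Written as a composition, it is visibly a permutation of the remaining points; it fixes \<open>z\<close>.
\<close>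

definition skip :: "'v \<Rightarrow> ('v \<Rightarrow> 'v) \<Rightarrow> 'v \<Rightarrow> 'v" where
  "skip z \<rho> = Transposition.transpose z (\<rho> z) \<circ> \<rho>"

lemma skip_permutes: "\<rho> permutes insert z S \<Longrightarrow> skip z \<rho> permutes S"
  unfolding skip_def by (rule permutes_insert_lemma)

lemma skip_eq: "inj \<rho> \<Longrightarrow> q \<noteq> z \<Longrightarrow> skip z \<rho> q = (if \<rho> q = z then \<rho> z else \<rho> q)"
  by (auto simp: skip_def Transposition.transpose_def dest: injD)

text \<open>
  Here \<open>z\<close> starts no edge of the word, so it occurs at most as the end of the edge coming from its
  predecessor.  The condition \<open>f (\<rho> z) = f z\<close> reroutes that edge to \<open>\<rho> z\<close>.  If \<open>\<rho> z = z\<close>, the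
  variable does not occur in the word at all, and its summation is free.
\<close>

lemma identify_vars:
  fixes \<rho> :: "'v \<Rightarrow> 'v" and a :: "'v \<Rightarrow> 'a::comm_complex_algebra"
  assumes \<rho>: "\<rho> permutes insert z (set xs)" and z: "z \<notin> set xs"
  shows "(\<Sum>f\<in>insert z (set xs) \<rightarrow>\<^sub>E (UNIV :: 'n::finite set).
       if f (\<rho> z) = f z then edge_word \<rho> a f xs else 0)
     = (if \<rho> z = z then of_nat CARD('n) else 1) *\<^sub>C perm_elem (skip z \<rho>) a xs"
proof -
  have inj: "inj \<rho>" by (rule permutes_inj[OF \<rho>])
  let ?F = "\<lambda>f :: 'v \<Rightarrow> 'n. if f (\<rho> z) = f z then edge_word \<rho> a f xs else 0"
  have word: "edge_word \<rho> a (g(z := v)) xs = edge_word (skip z \<rho>) a g xs"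
    if "\<rho> z = z \<or> v = g (\<rho> z)" for g :: "'v \<Rightarrow> 'n" and v
  proof (rule edge_word_cong)
    fix q assume "q \<in> set xs"
    then have q: "q \<noteq> z" using z by blast
    then have "\<rho> q = z \<Longrightarrow> \<rho> z \<noteq> z" using inj by (metis injD)
    with q that show "(g(z := v)) q = g q" "(g(z := v)) (\<rho> q) = g (skip z \<rho> q)"
      by (auto simp: skip_eq[OF inj q])
  qed simp
  have "(\<Sum>f\<in>insert z (set xs) \<rightarrow>\<^sub>E UNIV. ?F f)
      = (\<Sum>(v, g)\<in>UNIV \<times> (set xs \<rightarrow>\<^sub>E UNIV). ?F (g(z := v)))"
    unfolding PiE_insert_eq by (subst sum.reindex[OF inj_combinator[OF z]]) (simp add: comp_def case_prod_unfold)
  also have "\<dots> = (\<Sum>v\<in>UNIV. \<Sum>g\<in>set xs \<rightarrow>\<^sub>E UNIV. ?F (g(z := v)))"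
    by (rule sum.cartesian_product[symmetric])
  also have "\<dots> = (\<Sum>g\<in>set xs \<rightarrow>\<^sub>E UNIV. \<Sum>v\<in>UNIV. ?F (g(z := v)))"
    by (rule sum.swap)
  also have "\<dots> = (\<Sum>g\<in>set xs \<rightarrow>\<^sub>E UNIV. (if \<rho> z = z then of_nat CARD('n) else 1) *\<^sub>C edge_word (skip z \<rho>) a g xs)"
  proof (rule sum.cong[OF refl])
    fix g :: "'v \<Rightarrow> 'n"
    show "(\<Sum>v\<in>UNIV. ?F (g(z := v))) = (if \<rho> z = z then of_nat CARD('n) else 1) *\<^sub>C edge_word (skip z \<rho>) a g xs"
    proof (cases "\<rho> z = z")
      case True
      then show ?thesis
        using complex_vector.sum_constant_scale[of "edge_word (skip z \<rho>) a g xs" "UNIV :: 'n set"]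
        by (simp add: word)
    next
      case False
      then have "(\<Sum>v\<in>UNIV. ?F (g(z := v))) = (\<Sum>v\<in>UNIV. if g (\<rho> z) = v then edge_word (skip z \<rho>) a g xs else 0)"
        by (intro sum.cong) (auto simp: word)
      then show ?thesis using False by (simp add: scaleC_one)
    qed
  qed
  finally show ?thesis by (simp add: perm_elem_def complex_vector.scale_sum_right)
qed

text \<open>
  The edges at \<open>x\<close> and \<open>z\<close> end at \<open>\<pi> x\<close> and \<open>\<pi> z\<close>.  The first term of their commutator is the edge
  from \<open>x\<close> to \<open>\<pi> z = \<rho> x\<close>, with \<open>\<pi> x = \<rho> z\<close> identified with \<open>z\<close>; the second one is
  the edge from \<open>z\<close> to \<open>\<pi> x = \<rho> z\<close>, with \<open>\<pi> z = \<rho> x\<close> identified with \<open>x\<close>.  In terms of \<open>\<rho>\<close> both are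
  instances of \<open>identify_vars\<close>, for \<open>z\<close> and for \<open>x\<close>.
\<close>

lemma perm_elem_exchange:
  assumes \<pi>: "\<pi> permutes set (L @ [x, z] @ R)" and dist: "distinct (L @ [x, z] @ R)"
  defines "\<rho> \<equiv> \<pi> \<circ> Transposition.transpose x z"
  shows "(perm_elem \<pi> a (L @ [x, z] @ R) - perm_elem \<pi> a (L @ [z, x] @ R) ::
      ('n::finite gl, 'a::comm_complex_algebra) tensor uea) =
    (if \<rho> z = z then of_nat CARD('n) else 1) *\<^sub>C perm_elem (skip z \<rho>) (a(x := a x * a z)) (L @ [x] @ R) -
    (if \<rho> x = x then of_nat CARD('n) else 1) *\<^sub>C perm_elem (skip x \<rho>) (a(z := a x * a z)) (L @ [z] @ R)"
proof -
  let ?V = "set (L @ [x, z] @ R)"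
  have \<rho>: "\<rho> permutes ?V"
    unfolding \<rho>_def by (intro permutes_compose[OF _ \<pi>] permutes_swap_id) auto
  have V: "set (L @ [z, x] @ R) = ?V" "insert z (set (L @ [x] @ R)) = ?V" "insert x (set (L @ [z] @ R)) = ?V"
    by auto
  have \<rho>_eq: "\<rho> x = \<pi> z" "\<rho> z = \<pi> x" "q \<noteq> x \<Longrightarrow> q \<noteq> z \<Longrightarrow> \<rho> q = \<pi> q" for q
    by (auto simp: \<rho>_def)
  have word: "edge_word \<pi> a f (L @ [x, z] @ R) - edge_word \<pi> a f (L @ [z, x] @ R) =
      (if f (\<rho> z) = f z then edge_word \<rho> (a(x := a x * a z)) f (L @ [x] @ R) else 0) -
      (if f (\<rho> x) = f x then edge_word \<rho> (a(z := a x * a z)) f (L @ [z] @ R) else 0)" for f :: "'b \<Rightarrow> 'n"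
  proof -
    have *: "edge_word \<pi> a f L = edge_word \<rho> (a(x := a x * a z)) f L"
      "edge_word \<pi> a f R = edge_word \<rho> (a(x := a x * a z)) f R"
      "edge_word \<rho> (a(z := a x * a z)) f L = edge_word \<rho> (a(x := a x * a z)) f L"
      "edge_word \<rho> (a(z := a x * a z)) f R = edge_word \<rho> (a(x := a x * a z)) f R"
      using dist by (intro edge_word_cong; use \<rho>_eq(3) in fastforce)+
    have "edge_word \<pi> a f (L @ [x, z] @ R) - edge_word \<pi> a f (L @ [z, x] @ R) =
      edge_word \<pi> a f L * (gen_E (f x) (f (\<pi> x)) (a x) * gen_E (f z) (f (\<pi> z)) (a z)
        - gen_E (f z) (f (\<pi> z)) (a z) * gen_E (f x) (f (\<pi> x)) (a x)) * edge_word \<pi> a f R"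
      by (simp add: algebra_simps)
    also have "\<dots> = (if f (\<rho> z) = f z then edge_word \<rho> (a(x := a x * a z)) f (L @ [x] @ R) else 0) -
      (if f (\<rho> x) = f x then edge_word \<rho> (a(z := a x * a z)) f (L @ [z] @ R) else 0)"
      unfolding gen_E_commutator by (simp add: * \<rho>_eq algebra_simps)
    finally show ?thesis .
  qed
  have \<rho>': "\<rho> permutes insert z (set (L @ [x] @ R))" "\<rho> permutes insert x (set (L @ [z] @ R))"
    unfolding V by (rule \<rho>)+
  have notin: "z \<notin> set (L @ [x] @ R)" "x \<notin> set (L @ [z] @ R)"
    using dist by auto
  show ?thesis
    unfolding perm_elem_def[of \<pi>] V(1) sum_subtractf[symmetric] word
      identify_vars[OF \<rho>'(1) notin(1), symmetric] identify_vars[OF \<rho>'(2) notin(2), symmetric] V(2,3)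
    unfolding sum_subtractf ..
qed


section \<open>Sorting into products of trace elements\<close>

lemma trace_elem_eq_perm_elem:
  fixes a :: "'v \<Rightarrow> 'a::comm_complex_algebra"
  assumes "distinct xs" "\<And>j. j < length xs \<Longrightarrow> \<pi> (xs ! j) = xs ! (Suc j mod length xs)"
  shows "(trace_elem (map a xs) :: ('n::finite gl, 'a) tensor uea) = perm_elem \<pi> a xs"
  unfolding trace_elem_def perm_elem_def
proof (rule sum.reindex_bij_witness[where i = "\<lambda>f. map f xs" and
      j = "\<lambda>is. \<lambda>x\<in>set xs. the (map_of (zip xs is) x)"])
  fix "is" :: "'n list" assume "is \<in> {is. length is = length (map a xs)}"
  then have len: "length is = length xs" by simp
  let ?f = "\<lambda>x\<in>set xs. the (map_of (zip xs is) x)"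
  have f: "?f (xs ! j) = is ! j" if "j < length xs" for j
    using that assms(1) len by (simp add: map_of_zip_nth)
  have f_next: "?f (xs ! (Suc j mod length xs)) = is ! (Suc j mod length xs)" if "j < length xs" for j
    using that by (intro f mod_less_divisor) linarith
  show "map ?f xs = is"
    using len f by (intro nth_equalityI) auto
  show "edge_word \<pi> a ?f xs = (\<Prod>j\<leftarrow>[0..<length (map a xs)]. gen_E (is ! j)
          (is ! (Suc j mod length (map a xs))) (map a xs ! j))"
    unfolding edge_word_def
    by (intro arg_cong[of _ _ prod_list] nth_equalityI) (auto simp: f f_next assms(2) simp del: restrict_apply)
next
  fix f assume f: "f \<in> set xs \<rightarrow>\<^sub>E (UNIV :: 'n set)"
  show "(\<lambda>x\<in>set xs. the (map_of (zip xs (map f xs)) x)) = f"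
    using f by (auto simp: fun_eq_iff restrict_def PiE_def extensional_def map_of_zip_map)
qed auto

text \<open>
  Adjacent exchanges generate all rearrangements, and each of them costs only elements with one edge
  less.
\<close>

lemma perm_elem_rearrange:
  fixes V :: "('n::finite gl, 'a::comm_complex_algebra) tensor uea set" and \<pi> :: "'v \<Rightarrow> 'v"
  assumes V: "complex_vector.subspace V"
    and shorter: "\<And>(\<rho> :: 'v \<Rightarrow> 'v) b zs. \<rho> permutes set zs \<Longrightarrow> distinct zs \<Longrightarrow> zs \<noteq> [] \<Longrightarrow>
      length zs < length xs \<Longrightarrow> perm_elem \<rho> b zs \<in> V"
    and \<pi>: "\<pi> permutes set xs" and "distinct xs" "mset ys = mset xs"
  shows "perm_elem \<pi> a xs - perm_elem \<pi> a ys \<in> V"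
proof -
  have exchange: "perm_elem \<pi> a (L @ x # z # R) - perm_elem \<pi> a (L @ z # x # R) \<in> V"
    if eq: "mset (L @ x # z # R) = mset xs" for L x z R
  proof -
    have dist: "distinct (L @ [x, z] @ R)"
      using eq \<open>distinct xs\<close> mset_eq_imp_distinct_iff[OF eq] by simp
    have perm: "\<pi> permutes set (L @ [x, z] @ R)"
      using \<pi> mset_eq_setD[OF eq] by simp
    have len: "length (L @ [x] @ R) < length xs" "length (L @ [z] @ R) < length xs"
      using mset_eq_length[OF eq] by auto
    let ?\<rho> = "\<pi> \<circ> Transposition.transpose x z"
    have \<rho>: "?\<rho> permutes set (L @ [x, z] @ R)"
      by (intro permutes_compose[OF _ perm] permutes_swap_id) auto
    have "insert z (set (L @ [x] @ R)) = set (L @ [x, z] @ R)" "insert x (set (L @ [z] @ R)) = set (L @ [x, z] @ R)"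
      by auto
    then have "skip z ?\<rho> permutes set (L @ [x] @ R)" "skip x ?\<rho> permutes set (L @ [z] @ R)"
      using skip_permutes \<rho> by metis+
    then have "perm_elem (skip z ?\<rho>) b (L @ [x] @ R) \<in> V" "perm_elem (skip x ?\<rho>) b (L @ [z] @ R) \<in> V" for b
      using dist len shorter[of "skip z ?\<rho>" "L @ [x] @ R" b] shorter[of "skip x ?\<rho>" "L @ [z] @ R" b]
      by simp_all
    then have "perm_elem \<pi> a (L @ [x, z] @ R) - perm_elem \<pi> a (L @ [z, x] @ R) \<in> V"
      unfolding perm_elem_exchange[OF perm dist]
      by (intro complex_vector.subspace_diff[OF V] complex_vector.subspace_scale[OF V])
    then show ?thesis by simp
  qed
  have trans: "p - r \<in> V" if "p - q \<in> V" "q - r \<in> V" for p q r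
    using complex_vector.subspace_add[OF V that] by simp
  note zero = complex_vector.subspace_0[OF V]
  have move: "perm_elem \<pi> a (L @ x # M @ R) - perm_elem \<pi> a (L @ M @ x # R) \<in> V"
    if "mset (L @ x # M @ R) = mset xs" for L x M R
    using that
  proof (induction M arbitrary: L)
    case Nil
    show ?case by (simp add: zero)
  next
    case (Cons m M)
    have "perm_elem \<pi> a (L @ x # m # M @ R) - perm_elem \<pi> a (L @ m # x # M @ R) \<in> V"
      using Cons.prems by (intro exchange) simp
    moreover have "perm_elem \<pi> a ((L @ [m]) @ x # M @ R) - perm_elem \<pi> a ((L @ [m]) @ M @ x # R) \<in> V"
      using Cons.prems by (intro Cons.IH) (simp add: add_mset_commute)
    ultimately show ?case by (auto intro: trans)
  qed
  have "perm_elem \<pi> a (L @ us) - perm_elem \<pi> a (L @ vs) \<in> V"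
    if "mset vs = mset us" "mset (L @ us) = mset xs" for L us vs
    using that
  proof (induction us arbitrary: L vs)
    case Nil
    then show ?case by (simp add: zero)
  next
    case (Cons u us)
    have "u \<in> set vs" using mset_eq_setD[OF Cons.prems(1)] by simp
    then obtain v1 v2 where vs: "vs = v1 @ u # v2" by (meson split_list)
    have "mset (v1 @ v2) = mset us" using Cons.prems(1) by (simp add: vs)
    then have "perm_elem \<pi> a ((L @ [u]) @ us) - perm_elem \<pi> a ((L @ [u]) @ v1 @ v2) \<in> V"
      using Cons.prems by (intro Cons.IH) simp_all
    moreover have "perm_elem \<pi> a (L @ u # v1 @ v2) - perm_elem \<pi> a (L @ v1 @ u # v2) \<in> V"
      using Cons.prems by (intro move) (simp add: vs)
    ultimately show ?case by (auto intro: trans simp: vs)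
  qed
  from this[of ys xs "[]"] assms show ?thesis by simp
qed


lemma trace_algebra_mult:
  assumes "p \<in> trace_algebra" "q \<in> trace_algebra"
  shows "p * q \<in> trace_algebra"
proof -
  let ?S = "{prod_list us | us. us \<noteq> [] \<and> (\<forall>u\<in>set us. \<exists>as. as \<noteq> [] \<and> u = trace_elem as)}"
  have gens: "u * v \<in> complex_vector.span ?S" if "u \<in> ?S" "v \<in> ?S" for u v
  proof -
    from that obtain us vs where "u = prod_list us" "us \<noteq> []" "v = prod_list vs"
      "\<forall>w\<in>set us \<union> set vs. \<exists>as. as \<noteq> [] \<and> w = trace_elem as"
      by blast
    then show ?thesis
      by (intro complex_vector.span_base CollectI exI[of _ "us @ vs"]) simp
  qed
  have left: "u * q \<in> complex_vector.span ?S" if "u \<in> ?S" for u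
    using assms(2) unfolding trace_algebra_def
  proof (induction q rule: complex_vector.span_induct_alt)
    case (step c v q)
    then show ?case
      using gens[OF that]
      by (simp add: distrib_left uea_mult_scaleC complex_vector.span_add complex_vector.span_scale)
  qed (simp add: complex_vector.span_zero)
  show ?thesis
    using assms(1) unfolding trace_algebra_def
  proof (induction p rule: complex_vector.span_induct_alt)
    case (step c v p)
    then show ?case
      using left
      by (simp add: distrib_right uea_mult_scaleC complex_vector.span_add complex_vector.span_scale)
  qed (simp add: complex_vector.span_zero)
qed

lemma orbit_list:
  assumes "permutation \<pi>"
  obtains xs where "distinct xs" "set xs = orbit \<pi> i"
    "\<And>j. j < length xs \<Longrightarrow> \<pi> (xs ! j) = xs ! (Suc j mod length xs)"
proof
  have i: "i \<in> orbit \<pi> i" by (rule permutation_self_in_orbit[OF assms])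
  let ?k = "funpow_dist1 \<pi> i i"
  let ?xs = "map (\<lambda>n. (\<pi> ^^ n) i) [0..<?k]"
  show "distinct ?xs"
    using inj_on_funpow_dist1[OF i] by (simp add: distinct_map del: upt_Suc)
  show "set ?xs = orbit \<pi> i"
    using orbit_conv_funpow_dist1[OF i] by (simp del: upt_Suc)
  fix j assume "j < length ?xs"
  then have j: "j < ?k" by simp
  have "(\<pi> ^^ Suc j) i = (\<pi> ^^ (Suc j mod ?k)) i"
    using funpow_dist1_prop[OF i] j by (cases "Suc j = ?k") simp_all
  with j show "\<pi> (?xs ! j) = ?xs ! (Suc j mod length ?xs)"
    by (simp del: upt_Suc)
qed

lemma perm_elem_in_trace_algebra:
  assumes "\<pi> permutes set xs" "distinct xs" "xs \<noteq> []"
  shows "(perm_elem \<pi> a xs :: ('n::finite gl, 'a::comm_complex_algebra) tensor uea) \<in> trace_algebra"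
  using assms
proof (induction "length xs" arbitrary: \<pi> a xs rule: less_induct)
  case less
  have \<pi>: "permutation \<pi>" using less.prems(1) by (auto simp: permutation_permutes)
  \<comment> \<open>Put one cycle in front, listed along the cycle; the remaining edges form a shorter element.\<close>
  define i where "i = hd xs"
  have i: "i \<in> set xs" using less.prems(3) by (simp add: i_def)
  obtain c where c: "distinct c" "set c = orbit \<pi> i"
    "\<And>j. j < length c \<Longrightarrow> \<pi> (c ! j) = c ! (Suc j mod length c)"
    using orbit_list[OF \<pi>] by metis
  have c_sub: "set c \<subseteq> set xs"
    using c(2) permutes_orbit_subset[OF less.prems(1) i] by simp
  have "i \<in> set c" using c(2) permutation_self_in_orbit[OF \<pi>] by simp
  then have "c \<noteq> []" by auto
  define r where "r = filter (\<lambda>x. x \<notin> set c) xs"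
  have r: "distinct r" "set r = set xs - set c"
    using less.prems(2) by (auto simp: r_def)
  have "length r < length xs"
    unfolding r_def using \<open>i \<in> set c\<close> i by (intro length_filter_less) auto
  have "mset (c @ r) = mset xs"
    using c(1) r c_sub less.prems(2) by (subst set_eq_iff_mset_eq_distinct[symmetric]) auto
  then have "perm_elem \<pi> a xs - perm_elem \<pi> a (c @ r) \<in> (trace_algebra :: ('n gl, 'a) tensor uea set)"
    using less.prems(1,2) less.hyps by (intro perm_elem_rearrange) (auto simp: trace_algebra_def)
  moreover have "perm_elem \<pi> a (c @ r) \<in> (trace_algebra :: ('n gl, 'a) tensor uea set)"
  proof -
    have "perm_elem \<pi> a c = (trace_elem (map a c) :: ('n gl, 'a) tensor uea)"
      using c by (intro trace_elem_eq_perm_elem[symmetric])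
    also have "\<dots> \<in> trace_algebra"
      unfolding trace_algebra_def
      by (rule complex_vector.span_base, rule CollectI, rule exI[of _ "[trace_elem (map a c)]"])
        (use \<open>c \<noteq> []\<close> in auto)
    finally have c_elem: "perm_elem \<pi> a c \<in> (trace_algebra :: ('n gl, 'a) tensor uea set)" .
    show ?thesis
    proof (cases "r = []")
      case True
      with c_elem show ?thesis by simp
    next
      case False
      have c_closed: "\<pi> ` set c \<subseteq> set c"
        unfolding c(2) by (auto intro: orbit.step)
      have r_closed: "\<pi> ` set r \<subseteq> set r"
      proof safe
        fix p assume p: "p \<in> set r"
        have "\<pi> p \<notin> orbit \<pi> i"
        proof
          assume "\<pi> p \<in> orbit \<pi> i"
          moreover have "p \<in> orbit \<pi> (\<pi> p)"
            using permutation_orbit_step[OF \<pi>] permutation_self_in_orbit[OF \<pi>] by metis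
          ultimately have "p \<in> orbit \<pi> i" by (rule orbit_trans[rotated])
          with p r(2) c(2) show False by simp
        qed
        then show "\<pi> p \<in> set r"
          using p r(2) c(2) permutes_in_image[OF less.prems(1)] by simp
      qed
      have "inj_on \<pi> (set r)" using permutes_inj[OF less.prems(1)] by (rule inj_on_subset) simp
      then have "bij_betw \<pi> (set r) (set r)"
        using r_closed by (simp add: bij_betw_def endo_inj_surj)
      then have "perm_restrict \<pi> (set r) permutes set r"
        by (intro bij_imp_permutes) (auto simp: perm_restrict_simps cong: bij_betw_cong)
      then have "perm_elem (perm_restrict \<pi> (set r)) a r \<in> (trace_algebra :: ('n gl, 'a) tensor uea set)"
        using \<open>length r < length xs\<close> r(1) False by (intro less.hyps) auto
      also have "perm_elem (perm_restrict \<pi> (set r)) a r = perm_elem \<pi> a r"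
        by (intro perm_elem_cong) (simp_all add: perm_restrict_simps)
      finally have "perm_elem \<pi> a c * perm_elem \<pi> a r \<in> (trace_algebra :: ('n gl, 'a) tensor uea set)"
        by (rule trace_algebra_mult[OF c_elem])
      moreover have "set c \<inter> set r = {}" using r(2) by blast
      then have "perm_elem \<pi> a (c @ r) = (perm_elem \<pi> a c * perm_elem \<pi> a r :: ('n gl, 'a) tensor uea)"
        by (rule perm_elem_append[OF _ c_closed r_closed])
      ultimately show ?thesis by (simp only:)
    qed
  qed
  ultimately have "(perm_elem \<pi> a xs - perm_elem \<pi> a (c @ r)) + perm_elem \<pi> a (c @ r)
      \<in> (trace_algebra :: ('n gl, 'a) tensor uea set)"
    unfolding trace_algebra_def by (rule complex_vector.span_add)
  then show ?case by simp
qed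


section \<open>Merging cycles into one circuit\<close>

lemma circuit_elem_eq_perm_elem:
  assumes "\<pi> ` set xs = set xs"
  shows "circuit_elem ((\<lambda>x. (x, \<pi> x)) ` set xs) (map (\<lambda>x. (x, \<pi> x)) xs) (map a xs) = perm_elem \<pi> a xs"
proof -
  have "circuit_vars ((\<lambda>x. (x, \<pi> x)) ` set xs) = set xs"
    using assms by (auto simp: circuit_vars_def image_image)
  moreover have "zip (map (\<lambda>x. (x, \<pi> x)) xs) (map a xs) = map (\<lambda>x. ((x, \<pi> x), a x)) xs"
    by (simp add: zip_map_map zip_same_conv_map)
  ultimately show ?thesis
    by (simp add: circuit_elem_def perm_elem_def edge_word_def comp_def)
qed

lemma circuit_of_orbit:
  assumes "finite X" "\<pi> permutes X" "d \<in> X" "X \<subseteq> orbit \<pi> d"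
  shows "circuit ((\<lambda>x. (x, \<pi> x)) ` X)"
proof -
  let ?S = "(\<lambda>x. (x, \<pi> x)) ` X"
  have X: "orbit \<pi> p = X" if "p \<in> X" for p
    using cyclic_on_orbit[OF assms(2,1)] that assms(4) permutes_orbit_subset[OF assms(2,3)]
    by (intro orbit_cyclic_eq3[where S = X]) auto
  have conn: "((p, \<pi> p), (q, \<pi> q)) \<in> {(r, s). r \<in> ?S \<and> s \<in> ?S \<and> connected_pairs r s}\<^sup>*"
    if "p \<in> X" "q \<in> orbit \<pi> p" for p q
    using that(2)
  proof (induction q rule: orbit.induct)
    case base
    then show ?case using that(1) permutes_in_image[OF assms(2)]
      by (intro r_into_rtrancl) (auto simp: connected_pairs_def)
  next
    case (step q)
    have "q \<in> X" using step.hyps X[OF that(1)] by simp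
    then have "((q, \<pi> q), (\<pi> q, \<pi> (\<pi> q))) \<in> {(r, s). r \<in> ?S \<and> s \<in> ?S \<and> connected_pairs r s}"
      using permutes_in_image[OF assms(2)] by (auto simp: connected_pairs_def)
    with step.IH show ?case by (rule rtrancl_into_rtrancl)
  qed
  show ?thesis
    unfolding circuit_def
  proof (intro conjI ballI)
    show "inj_on snd ?S"
      using permutes_inj[OF assms(2)] by (auto simp: inj_on_def dest: injD)
    show "fst ` ?S = snd ` ?S"
      by (simp add: image_image permutes_image[OF assms(2)])
  qed (use assms X conn in \<open>auto simp: inj_on_def\<close>)
qed

text \<open>
  A permutation that agrees with \<open>\<tau>\<close> on the orbit of \<open>d\<close>, except that the edge into \<open>d\<close> is diverted
  to \<open>z\<close>, still reaches the whole orbit from \<open>d\<close>, and \<open>z\<close> as well.  Where \<open>z\<close> leads is left open, so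
  that this applies both when \<open>z\<close> returns to \<open>d\<close> directly and when it does so through another cycle.
\<close>

lemma orbit_insert_vertex:
  assumes "permutation \<tau>" "permutation \<pi>"
    and eq: "\<And>p. p \<in> orbit \<tau> d \<Longrightarrow> \<pi> p = (if \<tau> p = d then z else \<tau> p)"
  shows "insert z (orbit \<tau> d) \<subseteq> orbit \<pi> d"
proof -
  have self: "d \<in> orbit \<tau> d" "d \<in> orbit \<pi> d"
    using permutation_self_in_orbit assms(1,2) by metis+
  have sub: "p \<in> orbit \<pi> d" if "p \<in> orbit \<tau> d" for p
    using that
  proof induction
    case base
    show ?case using eq[OF self(1)] orbit.base[of \<pi> d] self(2) by (cases "\<tau> d = d") auto
  next
    case (step q)
    then show ?case using eq[OF step.hyps] orbit.step[of q \<pi> d] self(2) by (cases "\<tau> q = d") auto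
  qed
  obtain u where "u \<in> orbit \<tau> d" "\<tau> u = d"
    using self(1) by (metis orbit.cases)
  then have "z \<in> orbit \<pi> d"
    using eq[of u] sub[of u] orbit.step[of u \<pi> d] by simp
  with sub show ?thesis by blast
qed

text \<open>
  The vertex \<open>d\<close> is kept while its cycle absorbs the others; the induction is on the number of
  variables outside that cycle, and when there are none the element belongs to a single circuit.
\<close>

lemma perm_elem_in_circuit_span:
  fixes xs :: "nat list"
  assumes "\<tau> permutes set xs" "distinct xs" "d \<in> set xs"
  shows "(perm_elem \<tau> a xs :: ('n::finite gl, 'a::comm_complex_algebra) tensor uea) \<in> circuit_span"
  using assms
proof (induction "card (set xs - orbit \<tau> d)" arbitrary: \<tau> a xs rule: less_induct)
  case less
  note \<tau> = less.prems(1)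
  have perm\<tau>: "permutation \<tau>" using \<tau> by (auto simp: permutation_permutes)
  show ?case
  proof (cases "set xs \<subseteq> orbit \<tau> d")
    case True
    let ?S = "(\<lambda>x. (x, \<tau> x)) ` set xs" and ?\<sigma> = "map (\<lambda>x. (x, \<tau> x)) xs"
    have "perm_elem \<tau> a xs = (circuit_elem ?S ?\<sigma> (map a xs) :: ('n gl, 'a) tensor uea)"
      by (rule circuit_elem_eq_perm_elem[symmetric]) (rule permutes_image[OF \<tau>])
    moreover have "circuit ?S"
      by (rule circuit_of_orbit[OF _ \<tau> less.prems(3) True]) simp
    moreover have "order_of ?S ?\<sigma>" "length (map a xs) = card ?S"
      using less.prems(2) by (auto simp: order_of_def distinct_map inj_on_def card_image distinct_card)
    ultimately show ?thesis
      unfolding circuit_span_def by (intro complex_vector.span_base) blast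
  next
    case False
    then obtain x where x: "x \<in> set xs" "x \<notin> orbit \<tau> d" by blast
    then obtain L R where xs: "xs = L @ [x] @ R" by (metis append_Cons append_Nil split_list)
    obtain z where z: "z \<notin> set xs" using ex_new_if_finite[of "set xs"] by auto
    have ne: "z \<noteq> x" "z \<noteq> d" "x \<noteq> d"
      using x z less.prems(3) permutation_self_in_orbit[OF perm\<tau>, of d] by auto
    \<comment> \<open>\<open>\<rho>\<close> is \<open>\<tau>\<close> with \<open>z\<close> inserted in front of \<open>d\<close>, so removing \<open>z\<close> gives \<open>\<tau>\<close> back.  In \<open>\<pi>\<close> the
      images of \<open>x\<close> and \<open>z\<close> are exchanged, which joins the cycle of \<open>x\<close> to that of \<open>d\<close>.\<close>
    define \<rho> where "\<rho> = Transposition.transpose z d \<circ> \<tau>"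
    define \<pi> where "\<pi> = \<rho> \<circ> Transposition.transpose x z"
    let ?V = "insert z (set xs)"
    have \<rho>: "\<rho> permutes ?V"
      unfolding \<rho>_def using less.prems(3)
      by (intro permutes_compose permutes_swap_id permutes_subset[OF \<tau>]) auto
    have \<pi>: "\<pi> permutes ?V"
      unfolding \<pi>_def using x(1) by (intro permutes_compose[OF _ \<rho>] permutes_swap_id) auto
    have perm\<pi>: "permutation \<pi>" using \<pi> by (auto simp: permutation_permutes)
    have \<rho>z: "\<rho> z = d" using z permutes_not_in[OF \<tau>] by (simp add: \<rho>_def)
    have \<rho>_comp: "\<pi> \<circ> Transposition.transpose x z = \<rho>"
      by (simp add: \<pi>_def comp_assoc)
    have skip_z: "skip z \<rho> = \<tau>"
      by (simp add: skip_def \<rho>z) (simp add: \<rho>_def comp_assoc[symmetric])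
    have orbit_sub: "orbit \<tau> d \<subseteq> set xs"
      by (rule permutes_orbit_subset[OF \<tau> less.prems(3)])
    have \<rho>_orbit: "\<rho> p = (if \<tau> p = d then z else \<tau> p)" "\<rho> p \<noteq> x" "p \<noteq> x" "p \<noteq> z" if "p \<in> orbit \<tau> d" for p
    proof -
      have "\<tau> p \<in> orbit \<tau> d" using that by (rule orbit.step)
      then have "\<tau> p \<noteq> z" "\<tau> p \<noteq> x" using orbit_sub z x by auto
      then show "\<rho> p = (if \<tau> p = d then z else \<tau> p)" "\<rho> p \<noteq> x"
        using ne by (auto simp: \<rho>_def Transposition.transpose_def)
      show "p \<noteq> x" "p \<noteq> z" using that orbit_sub z x by auto
    qed
    have merged: "perm_elem \<pi> b ys \<in> (circuit_span :: ('n gl, 'a) tensor uea set)"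
      if "set ys = ?V" "distinct ys" for b ys
    proof -
      have "insert z (orbit \<tau> d) \<subseteq> orbit \<pi> d"
        using \<rho>_orbit by (intro orbit_insert_vertex[OF perm\<tau> perm\<pi>]) (auto simp: \<pi>_def)
      moreover have "x \<in> orbit \<pi> d"
      proof (rule orbit_swap[OF permutation_self_in_orbit[OF perm\<pi>]])
        have "\<pi> x = d" by (simp add: \<pi>_def \<rho>z)
        then show "d \<in> orbit \<pi> x" by (metis orbit.base)
      qed
      ultimately have "set ys - orbit \<pi> d \<subset> set xs - orbit \<tau> d"
        using that(1) x by blast
      then have "card (set ys - orbit \<pi> d) < card (set xs - orbit \<tau> d)"
        by (intro psubset_card_mono) auto
      then show ?thesis
        using that \<pi> less.prems(3) by (intro less.hyps) auto
    qed
    have shrunk: "perm_elem (skip x \<rho>) b (L @ [z] @ R) \<in> (circuit_span :: ('n gl, 'a) tensor uea set)" for b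
    proof -
      have set_eq: "set (L @ [z] @ R) = ?V - {x}" "insert x (set (L @ [z] @ R)) = ?V"
        using less.prems(2) z by (auto simp: xs)
      have \<kappa>: "skip x \<rho> permutes set (L @ [z] @ R)"
        by (rule skip_permutes, unfold set_eq(2), rule \<rho>)
      then have perm\<kappa>: "permutation (skip x \<rho>)" by (rule permutes_imp_permutation[rotated]) simp
      have "insert z (orbit \<tau> d) \<subseteq> orbit (skip x \<rho>) d"
        using \<rho>_orbit by (intro orbit_insert_vertex[OF perm\<tau> perm\<kappa>]) (simp add: skip_eq[OF permutes_inj[OF \<rho>]])
      then have "set (L @ [z] @ R) - orbit (skip x \<rho>) d \<subset> set xs - orbit \<tau> d"
        unfolding set_eq(1) using x by blast
      then have "card (set (L @ [z] @ R) - orbit (skip x \<rho>) d) < card (set xs - orbit \<tau> d)"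
        by (intro psubset_card_mono) auto
      moreover have "distinct (L @ [z] @ R)" "d \<in> set (L @ [z] @ R)"
        using less.prems z ne by (auto simp: xs)
      ultimately show ?thesis
        using \<kappa> by (intro less.hyps)
    qed
    have dist: "distinct (L @ [x, z] @ R)" "distinct (L @ [z, x] @ R)"
      and sets: "set (L @ [x, z] @ R) = ?V" "set (L @ [z, x] @ R) = ?V"
      using less.prems(2) z by (auto simp: xs)
    \<comment> \<open>The fused edge carries the product of both coefficients, which has to be \<open>a x\<close>.\<close>
    let ?a = "a(z := 1)"
    let ?b = "?a(z := ?a x * ?a z)"
    let ?k = "if \<rho> x = x then of_nat CARD('n) else 1 :: complex"
    have "perm_elem \<tau> (?a(x := ?a x * ?a z)) (L @ [x] @ R) = (perm_elem \<tau> a xs :: ('n gl, 'a) tensor uea)"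
      unfolding xs by (rule perm_elem_cong) (use z in \<open>auto simp: xs\<close>)
    then have "(perm_elem \<tau> a xs :: ('n gl, 'a) tensor uea) =
        perm_elem \<pi> ?a (L @ [x, z] @ R) - perm_elem \<pi> ?a (L @ [z, x] @ R)
        + ?k *\<^sub>C perm_elem (skip x \<rho>) ?b (L @ [z] @ R)"
      using perm_elem_exchange[where 'n = 'n, of \<pi> L x z R ?a, unfolded \<rho>_comp skip_z] \<pi> dist ne
      unfolding sets by (simp add: \<rho>z scaleC_one)
    also have "\<dots> \<in> circuit_span"
      unfolding circuit_span_def
      by (intro complex_vector.span_add complex_vector.span_diff complex_vector.span_scale;
          fold circuit_span_def; intro merged shrunk sets dist)
    finally show ?thesis .
  qed
qed


section \<open>Generators of the two spans as permutation elements\<close>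

text \<open>
  The factors use consecutive blocks of natural numbers as variables, so that different factors share
  none; hence the induction is over an arbitrary first variable \<open>m\<close>.  The bound on \<open>n\<close> records that a
  non-empty product involves at least one variable.
\<close>

lemma prod_trace_elems_eq_perm_elem:
  assumes "\<forall>u\<in>set us. \<exists>as. as \<noteq> [] \<and> u = trace_elem as"
  shows "\<exists>\<pi> a n. \<pi> permutes {m..<n} \<and> m + length us \<le> n \<and>
    (prod_list us :: ('n::finite gl, 'a::comm_complex_algebra) tensor uea) = perm_elem \<pi> a [m..<n]"
  using assms
proof (induction us arbitrary: m)
  case Nil
  show ?case
    by (intro exI[of _ id] exI[of _ "\<lambda>_. 1"] exI[of _ m]) (simp add: perm_elem_def permutes_id[unfolded id_def] id_def)
next
  case (Cons u us)
  from Cons.prems obtain as where as: "as \<noteq> []" "u = trace_elem as" by auto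
  define k where "k = m + length as"
  obtain \<pi>2 a2 n where \<pi>2: "\<pi>2 permutes {k..<n}" and n: "k + length us \<le> n"
    and us: "prod_list us = (perm_elem \<pi>2 a2 [k..<n] :: ('n gl, 'a) tensor uea)"
    using Cons.IH[of k] Cons.prems by auto
  have k: "m < k" "k \<le> n" using as(1) n by (auto simp: k_def)
  \<comment> \<open>the cyclic shift of the first block\<close>
  define \<pi>1 where "\<pi>1 = (\<lambda>p. if p \<in> {m..<k} then if Suc p = k then m else Suc p else p)"
  have "inj_on \<pi>1 {m..<k}" "\<pi>1 ` {m..<k} \<subseteq> {m..<k}"
    using k by (auto simp: \<pi>1_def inj_on_def)
  then have "bij_betw \<pi>1 {m..<k} {m..<k}"
    by (simp add: bij_betw_def endo_inj_surj)
  then have \<pi>1: "\<pi>1 permutes {m..<k}"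
    by (rule bij_imp_permutes) (auto simp: \<pi>1_def)
  let ?\<pi> = "\<pi>1 \<circ> \<pi>2" and ?a = "\<lambda>p. if p < k then as ! (p - m) else a2 p"
  have \<pi>: "?\<pi> permutes {m..<n}"
    using k by (intro permutes_compose permutes_subset[OF \<pi>1] permutes_subset[OF \<pi>2]) auto
  have left: "?\<pi> p = \<pi>1 p" if "p \<in> {m..<k}" for p
    using that permutes_not_in[OF \<pi>2, of p] by simp
  have right: "?\<pi> p = \<pi>2 p" if "p \<in> {k..<n}" for p
    using that permutes_in_image[OF \<pi>2, of p] permutes_not_in[OF \<pi>1, of "\<pi>2 p"] by simp
  have "map ?a [m..<k] = as"
    by (rule nth_equalityI) (auto simp: k_def)
  moreover have "trace_elem (map ?a [m..<k]) = (perm_elem ?\<pi> ?a [m..<k] :: ('n gl, 'a) tensor uea)"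
  proof (rule trace_elem_eq_perm_elem)
    fix j assume j: "j < length [m..<k]"
    then show "?\<pi> ([m..<k] ! j) = [m..<k] ! (Suc j mod length [m..<k])"
      using left[of "m + j"] by (cases "Suc j = k - m") (auto simp: \<pi>1_def)
  qed simp
  moreover have "prod_list us = (perm_elem ?\<pi> ?a [k..<n] :: ('n gl, 'a) tensor uea)"
    unfolding us using right by (intro perm_elem_cong) auto
  moreover have "perm_elem ?\<pi> ?a ([m..<k] @ [k..<n]) =
      (perm_elem ?\<pi> ?a [m..<k] * perm_elem ?\<pi> ?a [k..<n] :: ('n gl, 'a) tensor uea)"
  proof (rule perm_elem_append)
    show "?\<pi> ` set [m..<k] \<subseteq> set [m..<k]"
      using left permutes_in_image[OF \<pi>1] by auto
    show "?\<pi> ` set [k..<n] \<subseteq> set [k..<n]"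
      using right permutes_in_image[OF \<pi>2] by auto
  qed auto
  moreover have "[m..<k] @ [k..<n] = [m..<n]"
    using k by (metis less_imp_le_nat upt_add_eq_append le_add_diff_inverse)
  ultimately have "prod_list (u # us) = (perm_elem ?\<pi> ?a [m..<n] :: ('n gl, 'a) tensor uea)"
    using as(2) by simp
  moreover have "m + length (u # us) \<le> n"
    using k n by simp
  ultimately show ?case
    using \<pi> by blast
qed

text \<open>
  As the start points of the edges are distinct, as are the end points, and both form the same set,
  the map from start to end point is a permutation of the variables.
\<close>

lemma circuit_elem_obtain_perm_elem:
  fixes S :: "('v \<times> 'v) set" and as :: "'a::comm_complex_algebra list"
  assumes "circuit S" "order_of S \<sigma>" "length as = card S"
  obtains \<pi> :: "'v \<Rightarrow> 'v" and a xs where "\<pi> permutes set xs" "distinct xs" "xs \<noteq> []"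
    "(circuit_elem S \<sigma> as :: ('n::finite gl, 'a) tensor uea) = perm_elem \<pi> a xs"
proof -
  from assms have S: "finite S" "S \<noteq> {}" "inj_on fst S" "inj_on snd S" "fst ` S = snd ` S"
    and \<sigma>: "distinct \<sigma>" "set \<sigma> = S" and len: "length as = length \<sigma>"
    by (auto simp: circuit_def order_of_def distinct_card)
  define xs where "xs = map fst \<sigma>"
  define \<pi> where "\<pi> = (\<lambda>x. case map_of \<sigma> x of Some y \<Rightarrow> y | None \<Rightarrow> x)"
  define a where "a = (\<lambda>x. the (map_of (zip xs as) x))"
  have len_xs: "length as = length xs" using len by (simp add: xs_def)
  have dist: "distinct xs" using S(3) \<sigma> by (simp add: xs_def distinct_map)
  have \<pi>: "\<pi> (fst e) = snd e" if "e \<in> S" for e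
    using that dist \<sigma>(2) by (simp add: \<pi>_def xs_def map_of_eq_Some_iff[of \<sigma> "fst e" "snd e", THEN iffD2])
  have "map (\<lambda>x. (x, \<pi> x)) xs = \<sigma>"
    unfolding xs_def map_map by (rule map_idI) (use \<pi> \<sigma>(2) in simp)
  moreover from this have "(\<lambda>x. (x, \<pi> x)) ` set xs = S"
    using \<sigma>(2) by (metis set_map)
  moreover have "map a xs = as"
    using dist by (intro nth_equalityI) (auto simp: a_def map_of_zip_nth len_xs)
  moreover have image: "\<pi> ` set xs = set xs"
  proof -
    have "\<pi> ` fst ` S = snd ` S"
      unfolding image_image using \<pi> by (rule image_cong[OF refl])
    then show ?thesis using S(5) \<sigma>(2) by (simp add: xs_def)
  qed
  ultimately have eq: "(circuit_elem S \<sigma> as :: ('n gl, 'a) tensor uea) = perm_elem \<pi> a xs"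
    using circuit_elem_eq_perm_elem[of \<pi> xs a] by simp
  have "bij_betw \<pi> (set xs) (set xs)"
    using image by (simp add: bij_betw_def eq_card_imp_inj_on)
  then have "\<pi> permutes set xs"
    by (rule bij_imp_permutes) (simp add: \<pi>_def xs_def map_of_eq_None_iff[THEN iffD2])
  moreover have "xs \<noteq> []" using S(2) \<sigma>(2) by (auto simp: xs_def)
  ultimately show thesis using that dist eq by blast
qed

theorem theorem5p10:
  shows "(circuit_span :: ('n::finite gl, 'a::comm_complex_algebra) tensor uea set) = trace_algebra"
proof
  show "(circuit_span :: ('n gl, 'a) tensor uea set) \<subseteq> trace_algebra"
    unfolding circuit_span_def
  proof (rule complex_vector.span_minimal)
    show "complex_vector.subspace (trace_algebra :: ('n gl, 'a) tensor uea set)"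
      by (simp add: trace_algebra_def)
    show "{circuit_elem S \<sigma> as | (S :: (nat \<times> nat) set) \<sigma> as. circuit S \<and> order_of S \<sigma> \<and> length as = card S}
        \<subseteq> (trace_algebra :: ('n gl, 'a) tensor uea set)"
    proof clarify
      fix S :: "(nat \<times> nat) set" and \<sigma> and as :: "'a list"
      assume "circuit S" "order_of S \<sigma>" "length as = card S"
      then obtain \<pi> :: "nat \<Rightarrow> nat" and a xs where "\<pi> permutes set xs" "distinct xs" "xs \<noteq> []"
        "circuit_elem S \<sigma> as = (perm_elem \<pi> a xs :: ('n gl, 'a) tensor uea)"
        by (rule circuit_elem_obtain_perm_elem)
      then show "(circuit_elem S \<sigma> as :: ('n gl, 'a) tensor uea) \<in> trace_algebra"
        using perm_elem_in_trace_algebra by metis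
    qed
  qed
  show "trace_algebra \<subseteq> (circuit_span :: ('n gl, 'a) tensor uea set)"
    unfolding trace_algebra_def
  proof (rule complex_vector.span_minimal)
    show "{prod_list us | us. us \<noteq> [] \<and> (\<forall>u\<in>set us. \<exists>as. as \<noteq> [] \<and> u = trace_elem as)}
        \<subseteq> (circuit_span :: ('n gl, 'a) tensor uea set)"
    proof clarify
      fix us :: "('n gl, 'a) tensor uea list"
      assume "us \<noteq> []" "\<forall>u\<in>set us. \<exists>as. as \<noteq> [] \<and> u = trace_elem as"
      with prod_trace_elems_eq_perm_elem[of us 0] obtain \<pi> a n where
        "\<pi> permutes {0..<n}" "length us \<le> n" "prod_list us = perm_elem \<pi> a [0..<n]"
        by auto
      moreover from this \<open>us \<noteq> []\<close> have "0 < n" by (cases us) auto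
      ultimately show "prod_list us \<in> circuit_span"
        by (auto intro!: perm_elem_in_circuit_span[where d = 0])
    qed
  qed (simp add: circuit_span_def)
qed

end
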